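(* For a generic $V \in \ell^\infty(\mathbb{Z})$, the essential spectrum $\sigma_{\mathrm{ess}}(H_V)$ of the associated Schr\"odinger operator $H_V$ is a Cantor set.
   Context: $\ell^\infty(\mathbb{Z})$ denotes the space of bounded real-valued functions $V:\mathbb{Z}\to\mathbb{R}$ (potentials), equipped with the uniform norm $\|\cdot\|_\infty$. For $V \in \ell^\infty(\mathbb{Z})$, $H_V$ is the bounded self-adjoint operator on $\ell^2(\mathbb{Z})$ given by $[H_V\psi](n)=\psi(n+1)+\psi(n-1)+V(n)\psi(n)$. An assertion holds for a generic $V$ if there is a dense $G_\delta$ subset of $\ell^\infty(\mathbb{Z})$ (with respect to $\|\cdot\|_\infty$) such that the assertion is true for all $V$ in this subset. The essential spectrum $\sigma_{\mathrm{ess}}(H_V)$ is the spectrum of $H_V$ with the isolated eigenvalues of finite multiplicity removed. A subset of $\mathbb{R}$ is called a Cantor set if it is compact, has no isolated points, and has empty interior. *)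

theory Defs
  imports "HOL-Analysis.Analysis"
begin

section \<open>The complex Hilbert space of square-summable sequences on the integers\<close>

definition square_summable :: "(int \<Rightarrow> complex) \<Rightarrow> bool" where
  "square_summable \<psi> \<longleftrightarrow> (\<lambda>n. (cmod (\<psi> n))\<^sup>2) summable_on UNIV"

lemma square_summable_zero: "square_summable (\<lambda>_. 0)"
  by (simp add: square_summable_def)

lemma square_summable_bounded_mult:
  assumes "square_summable \<psi>" "\<And>n. cmod (c n) \<le> C"
  shows "square_summable (\<lambda>n. c n * \<psi> n)"
  unfolding square_summable_def
proof (rule summable_on_comparison_test)
  show "(\<lambda>n. C\<^sup>2 * (cmod (\<psi> n))\<^sup>2) summable_on UNIV"
    using assms(1) unfolding square_summable_def by (rule summable_on_cmult_right)
  show "(cmod (c n * \<psi> n))\<^sup>2 \<le> C\<^sup>2 * (cmod (\<psi> n))\<^sup>2" for n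
    by (simp add: norm_mult power_mult_distrib mult_right_mono power_mono assms(2))
qed auto

lemma square_summable_add:
  assumes "square_summable \<psi>" "square_summable \<phi>"
  shows "square_summable (\<lambda>n. \<psi> n + \<phi> n)"
  unfolding square_summable_def
proof (rule summable_on_comparison_test)
  show "(\<lambda>n. 2 * (cmod (\<psi> n))\<^sup>2 + 2 * (cmod (\<phi> n))\<^sup>2) summable_on UNIV"
    using assms unfolding square_summable_def
    by (intro summable_on_add summable_on_cmult_right)
  show "(cmod (\<psi> n + \<phi> n))\<^sup>2 \<le> 2 * (cmod (\<psi> n))\<^sup>2 + 2 * (cmod (\<phi> n))\<^sup>2" for n
  proof -
    have "(cmod (\<psi> n + \<phi> n))\<^sup>2 \<le> (cmod (\<psi> n) + cmod (\<phi> n))\<^sup>2"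
      by (intro power_mono norm_triangle_ineq) auto
    also have "\<dots> \<le> 2 * (cmod (\<psi> n))\<^sup>2 + 2 * (cmod (\<phi> n))\<^sup>2"
      using sum_squares_bound[of "cmod (\<psi> n)" "cmod (\<phi> n)"] by (simp add: power2_sum)
    finally show ?thesis .
  qed
qed auto

lemma square_summable_shift:
  assumes "square_summable \<psi>"
  shows "square_summable (\<lambda>n. \<psi> (n + k))"
proof -
  have "bij_betw (\<lambda>n::int. n + k) UNIV UNIV"
    by (rule bij_betw_byWitness[where f' = "\<lambda>n. n - k"]) auto
  from summable_on_reindex_bij_betw[OF this, of "\<lambda>n. (cmod (\<psi> n))\<^sup>2"] show ?thesis
    using assms by (simp add: square_summable_def)
qed

lemma square_summable_inner:
  assumes "square_summable \<psi>" "square_summable \<phi>"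
  shows "(\<lambda>n. \<psi> n \<bullet> \<phi> n) summable_on UNIV"
proof (rule abs_summable_summable, rule summable_on_comparison_test)
  show "(\<lambda>n. (cmod (\<psi> n))\<^sup>2 + (cmod (\<phi> n))\<^sup>2) summable_on UNIV"
    using assms unfolding square_summable_def by (rule summable_on_add)
  show "norm (\<psi> n \<bullet> \<phi> n) \<le> (cmod (\<psi> n))\<^sup>2 + (cmod (\<phi> n))\<^sup>2" for n
  proof -
    have "norm (\<psi> n \<bullet> \<phi> n) \<le> cmod (\<psi> n) * cmod (\<phi> n)"
      by (simp add: Cauchy_Schwarz_ineq2)
    moreover have "0 \<le> cmod (\<psi> n) * cmod (\<phi> n)" by simp
    ultimately show ?thesis
      using sum_squares_bound[of "cmod (\<psi> n)" "cmod (\<phi> n)"] by linarith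
  qed
qed auto

typedef ell2 = "{\<psi> :: int \<Rightarrow> complex. square_summable \<psi>}"
  morphisms ell2_nth Abs_ell2
  using square_summable_zero by blast

setup_lifting type_definition_ell2

instantiation ell2 :: real_vector
begin

lift_definition zero_ell2 :: ell2 is "\<lambda>_. 0"
  by (rule square_summable_zero)

lift_definition plus_ell2 :: "ell2 \<Rightarrow> ell2 \<Rightarrow> ell2" is "\<lambda>\<psi> \<phi> n. \<psi> n + \<phi> n"
  by (rule square_summable_add)

lift_definition uminus_ell2 :: "ell2 \<Rightarrow> ell2" is "\<lambda>\<psi> n. - \<psi> n"
  by (simp add: square_summable_def)

lift_definition minus_ell2 :: "ell2 \<Rightarrow> ell2 \<Rightarrow> ell2" is "\<lambda>\<psi> \<phi> n. \<psi> n - \<phi> n"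
proof -
  fix \<psi> \<phi> :: "int \<Rightarrow> complex"
  assume "square_summable \<psi>" "square_summable \<phi>"
  then have "square_summable (\<lambda>n. \<psi> n + - \<phi> n)"
    by (intro square_summable_add) (simp_all add: square_summable_def)
  then show "square_summable (\<lambda>n. \<psi> n - \<phi> n)" by simp
qed

lift_definition scaleR_ell2 :: "real \<Rightarrow> ell2 \<Rightarrow> ell2" is "\<lambda>r \<psi> n. r *\<^sub>R \<psi> n"
  unfolding scaleR_conv_of_real by (rule square_summable_bounded_mult[OF _ order_refl])

instance
  by standard (transfer; simp add: fun_eq_iff algebra_simps)+

end

text \<open>The real inner product below is the real part of the usual complex one.\<close>

instantiation ell2 :: real_inner
begin

lift_definition inner_ell2 :: "ell2 \<Rightarrow> ell2 \<Rightarrow> real" is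
  "\<lambda>\<psi> \<phi>. \<Sum>\<^sub>\<infinity>n. \<psi> n \<bullet> \<phi> n" .

lift_definition norm_ell2 :: "ell2 \<Rightarrow> real" is
  "\<lambda>\<psi>. sqrt (\<Sum>\<^sub>\<infinity>n. (cmod (\<psi> n))\<^sup>2)" .

definition sgn_ell2 :: "ell2 \<Rightarrow> ell2" where "sgn_ell2 \<psi> = \<psi> /\<^sub>R norm \<psi>"

definition dist_ell2 :: "ell2 \<Rightarrow> ell2 \<Rightarrow> real" where "dist_ell2 \<psi> \<phi> = norm (\<psi> - \<phi>)"

definition uniformity_ell2 :: "(ell2 \<times> ell2) filter" where
  "uniformity_ell2 = (INF e\<in>{0<..}. principal {(\<psi>, \<phi>). dist \<psi> \<phi> < e})"

definition open_ell2 :: "ell2 set \<Rightarrow> bool" where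
  "open_ell2 U \<longleftrightarrow> (\<forall>x\<in>U. eventually (\<lambda>(x', y). x' = x \<longrightarrow> y \<in> U) uniformity)"

instance
proof
  fix x y z :: ell2 and r :: real
  show "inner x y = inner y x"
    by transfer (simp only: inner_commute)
  show "inner (x + y) z = inner x z + inner y z"
    by transfer (simp only: inner_add_left infsum_add square_summable_inner)
  show "inner (r *\<^sub>R x) y = r * inner x y"
    by transfer (simp add: infsum_cmult_right')
  show "0 \<le> inner x x"
    by transfer (simp add: infsum_nonneg)
  show "inner x x = 0 \<longleftrightarrow> x = 0"
  proof transfer
    fix \<psi> :: "int \<Rightarrow> complex" assume "square_summable \<psi>"
    note summable = square_summable_inner[OF this this]
    have "\<psi> = (\<lambda>_. 0)" if zero: "(\<Sum>\<^sub>\<infinity>n. \<psi> n \<bullet> \<psi> n) = 0"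
    proof
      fix n
      have "\<psi> n \<bullet> \<psi> n = 0"
        by (rule nonneg_infsum_le_0D[OF eq_refl[OF zero] summable]) (rule inner_ge_zero, rule UNIV_I)
      then show "\<psi> n = 0" by (simp only: inner_eq_zero_iff)
    qed
    moreover have "(\<Sum>\<^sub>\<infinity>n. \<psi> n \<bullet> \<psi> n) = 0" if "\<psi> = (\<lambda>_. 0)"
      by (simp only: that inner_zero_left infsum_0_simp)
    ultimately show "((\<Sum>\<^sub>\<infinity>n. \<psi> n \<bullet> \<psi> n) = 0) = (\<psi> = (\<lambda>_. 0))"
      by (rule iffI)
  qed
  show "norm x = sqrt (inner x x)"
    by transfer (simp only: power2_norm_eq_inner)
qed (simp_all only: sgn_ell2_def dist_ell2_def uniformity_ell2_def open_ell2_def)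

end

lift_definition scaleC_ell2 :: "complex \<Rightarrow> ell2 \<Rightarrow> ell2"  (infixr \<open>*\<^sub>C\<close> 75)
  is "\<lambda>c \<psi> n. c * \<psi> n"
  by (rule square_summable_bounded_mult[OF _ order_refl])

interpretation complex_ell2: vector_space scaleC_ell2
  by standard (transfer; simp add: fun_eq_iff algebra_simps)+

section \<open>Spectrum and essential spectrum\<close>

text \<open>
  For a complex-linear \<open>A\<close>, a real-linear two-sided inverse of \<open>A - z\<close> is automatically
  complex-linear, so the real notion \<^const>\<open>bounded_linear\<close> suffices.
\<close>

definition resolvent_set :: "(ell2 \<Rightarrow> ell2) \<Rightarrow> complex set" where
  "resolvent_set A = {z. \<exists>R. bounded_linear R \<and>
     (\<forall>\<psi>. R (A \<psi> - z *\<^sub>C \<psi>) = \<psi>) \<and> (\<forall>\<psi>. A (R \<psi>) - z *\<^sub>C R \<psi> = \<psi>)}"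

definition spectrum :: "(ell2 \<Rightarrow> ell2) \<Rightarrow> complex set" where
  "spectrum A = - resolvent_set A"

definition eigenspace :: "(ell2 \<Rightarrow> ell2) \<Rightarrow> complex \<Rightarrow> ell2 set" where
  "eigenspace A z = {\<psi>. A \<psi> = z *\<^sub>C \<psi>}"

definition eigenvalue :: "(ell2 \<Rightarrow> ell2) \<Rightarrow> complex \<Rightarrow> bool" where
  "eigenvalue A z \<longleftrightarrow> (\<exists>\<psi>\<in>eigenspace A z. \<psi> \<noteq> 0)"

definition finite_multiplicity :: "(ell2 \<Rightarrow> ell2) \<Rightarrow> complex \<Rightarrow> bool" where
  "finite_multiplicity A z \<longleftrightarrow> (\<exists>B. finite B \<and> eigenspace A z \<subseteq> complex_ell2.span B)"

text \<open>
  This is the usual notion for self-adjoint \<open>A\<close>, where geometric and algebraic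
  multiplicities coincide. An eigenvalue is isolated if it is an isolated point of the
  whole spectrum.
\<close>

definition essential_spectrum :: "(ell2 \<Rightarrow> ell2) \<Rightarrow> complex set" where
  "essential_spectrum A =
     spectrum A - {z. z isolated_in spectrum A \<and> eigenvalue A z \<and> finite_multiplicity A z}"

section \<open>Schroedinger operators with bounded potentials\<close>

text \<open>
  Since \<^typ>\<open>int\<close> carries the discrete topology, \<open>int \<Rightarrow>\<^sub>C real\<close> consists of all bounded
  functions from the integers to the reals, and its norm is the uniform norm.
\<close>

type_synonym potential = "int \<Rightarrow>\<^sub>C real"

lift_definition schroedinger :: "potential \<Rightarrow> ell2 \<Rightarrow> ell2" is
  "\<lambda>(V :: potential) \<psi> n. \<psi> (n + 1) + \<psi> (n - 1) + complex_of_real (apply_bcontfun V n) * \<psi> n"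
proof -
  fix V :: potential and \<psi> :: "int \<Rightarrow> complex"
  assume \<psi>: "square_summable \<psi>"
  have "square_summable (\<lambda>n. complex_of_real (V n) * \<psi> n)"
    using norm_bounded[of V]
    by (intro square_summable_bounded_mult[OF \<psi>, of _ "norm V"]) simp
  then show "square_summable (\<lambda>n. \<psi> (n + 1) + \<psi> (n - 1) + complex_of_real (V n) * \<psi> n)"
    using square_summable_shift[OF \<psi>, of 1] square_summable_shift[OF \<psi>, of "-1"]
    by (intro square_summable_add) simp_all
qed

definition generic :: "('a::topological_space \<Rightarrow> bool) \<Rightarrow> bool" where
  "generic P \<longleftrightarrow> (\<exists>G. gdelta G \<and> closure G = UNIV \<and> (\<forall>x\<in>G. P x))"

definition cantor_set :: "real set \<Rightarrow> bool" where
  "cantor_set K \<longleftrightarrow> compact K \<and> (\<forall>x. \<not> x isolated_in K) \<and> interior K = {}"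

end

theory Submission
  imports Defs
begin

text \<open>
  Call \<open>E\<close> a Weyl energy of \<open>V\<close> if \<open>H\<^bsub>V\<^esub> - E\<close> is not bounded below on
  vectors supported far from the origin. Off these energies an approximate eigenvector is controlled by
  finitely many of its entries, so the rest of the spectrum consists of isolated eigenvalues; hence the
  essential spectrum is the set of Weyl energies as soon as the latter has no isolated points.

  For empty interior, each single energy \<open>E\<close> can be expelled from the Weyl spectrum by an
  arbitrarily small perturbation. Perturb the potential by random signs times \<open>\<delta>\<close>: the
  determinant of the second moment matrix of a solution of \<open>H\<psi> = E\<psi>\<close> then grows
  exponentially, so on blocks of a fixed length some choice of signs doubles the solution. Concatenating
  blocks gives a uniformly growing solution on each half-line, i.e. an exponential dichotomy.

  For the absence of isolated points, a Weyl energy is split in two by shifting the potential on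
  every other one of a sequence of disjointly supported approximate eigenvectors, and a Rayleigh
  quotient argument shows that meeting a given open interval is an open condition on \<open>V\<close>.
\<close>

section \<open>Uniformly growing solutions on a half-line\<close>

text \<open>The determinant is the right quantity because an unperturbed step acts on the second
  moment matrix by congruence with a transfer matrix of determinant 1, which preserves it, while
  each independent sign adds a nonnegative term. Growth therefore comes with a rate depending only
  on the size of the signs, and a block length depending also on a bound for the potential minus the
  energy; both can be fixed before the blocks are chosen.

  Testing only vectors supported away from the origin decouples the two half-lines. The growing
  solutions on the left and on the right never have to be matched, and one half-line estimate serves
  both sides by reflection.

  The two Baire conditions differ in difficulty. Having no Weyl energy at a given point is stable
  under small perturbation, since a lower bound survives. Having one in an open interval is the
  delicate condition: Weyl energies must not disappear when the potential moves. This is what the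
  Rayleigh quotient argument secures, in place of spectral projections.\<close>

lemma weighted_square_le:
  fixes q s b :: real
  assumes "0 < q" "q < 1"
  shows "(q * s + b)\<^sup>2 \<le> q * s\<^sup>2 + b\<^sup>2 / (1 - q)"
proof -
  have "q * s\<^sup>2 + b\<^sup>2 / (1 - q) - (q * s + b)\<^sup>2 = q / (1 - q) * ((1 - q) * s - b)\<^sup>2"
    using assms by (simp add: field_simps power2_eq_square)
  moreover have "0 \<le> q / (1 - q) * ((1 - q) * s - b)\<^sup>2"
    using assms by simp
  ultimately show ?thesis by linarith
qed

text \<open>Convexity of the square, with weights \<open>q\<close> and \<open>1 - q\<close>, keeps
  the contraction factor \<open>q\<close> after squaring. The constant is the one of Young's
  inequality for convolution with the geometric sequence of ratio \<open>q\<close>, whose sum is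
  \<open>1 / (1 - q)\<close>.\<close>

lemma forward_recursion_l2:
  fixes a b :: "nat \<Rightarrow> real"
  assumes q: "0 < q" "q < 1" and a0: "a 0 = 0" and nonneg: "\<And>n. 0 \<le> a n"
    and step: "\<And>n. a (Suc n) \<le> q * a n + b n"
  shows "(\<Sum>n<L. (a n)\<^sup>2) \<le> (\<Sum>n<L. (b n)\<^sup>2) / (1 - q)\<^sup>2"
proof -
  have "(a (Suc n))\<^sup>2 \<le> q * (a n)\<^sup>2 + (b n)\<^sup>2 / (1 - q)" for n
    using power_mono[OF step nonneg, of n 2] weighted_square_le[OF q, of "a n" "b n"] by linarith
  then have "(\<Sum>n<L. (a (Suc n))\<^sup>2) \<le> (\<Sum>n<L. q * (a n)\<^sup>2 + (b n)\<^sup>2 / (1 - q))"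
    by (intro sum_mono)
  also have "\<dots> = q * (\<Sum>n<L. (a n)\<^sup>2) + (\<Sum>n<L. (b n)\<^sup>2) / (1 - q)"
    by (simp add: sum.distrib sum_distrib_left sum_divide_distrib)
  also have "(\<Sum>n<L. (a (Suc n))\<^sup>2) = (\<Sum>n<Suc L. (a n)\<^sup>2)"
    by (simp add: sum.lessThan_Suc_shift a0 del: sum.lessThan_Suc)
  finally have "(1 - q) * (\<Sum>n<L. (a n)\<^sup>2) \<le> (\<Sum>n<L. (b n)\<^sup>2) / (1 - q)"
    by (simp add: algebra_simps) (use zero_le_power2[of "a L"] in linarith)
  then have "(\<Sum>n<L. (a n)\<^sup>2) \<le> (\<Sum>n<L. (b n)\<^sup>2) / (1 - q) / (1 - q)"
    using q by (subst pos_le_divide_eq) (simp_all add: mult.commute)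
  then show ?thesis
    by (simp add: power2_eq_square)
qed

lemma backward_recursion_l2:
  fixes y b :: "nat \<Rightarrow> real"
  assumes q: "0 < q" "q < 1" and yL: "y L = 0" and nonneg: "\<And>n. 0 \<le> y n"
    and step: "\<And>n. y n \<le> q * y (Suc n) + b n"
  shows "(\<Sum>n<L. (y n)\<^sup>2) \<le> (\<Sum>n<L. (b n)\<^sup>2) / (1 - q)\<^sup>2"
proof -
  have "(y n)\<^sup>2 \<le> q * (y (Suc n))\<^sup>2 + (b n)\<^sup>2 / (1 - q)" for n
    using power_mono[OF step nonneg, of n 2] weighted_square_le[OF q, of "y (Suc n)" "b n"] by linarith
  then have "(\<Sum>n<L. (y n)\<^sup>2) \<le> (\<Sum>n<L. q * (y (Suc n))\<^sup>2 + (b n)\<^sup>2 / (1 - q))"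
    by (intro sum_mono)
  also have "\<dots> = q * (\<Sum>n<L. (y (Suc n))\<^sup>2) + (\<Sum>n<L. (b n)\<^sup>2) / (1 - q)"
    by (simp add: sum.distrib sum_distrib_left sum_divide_distrib)
  finally have 1: "(\<Sum>n<L. (y n)\<^sup>2) \<le> q * (\<Sum>n<L. (y (Suc n))\<^sup>2) + (\<Sum>n<L. (b n)\<^sup>2) / (1 - q)" .
  have "(\<Sum>n<L. (y (Suc n))\<^sup>2) + (y 0)\<^sup>2 = (\<Sum>n<L. (y n)\<^sup>2) + (y L)\<^sup>2"
    using sum.lessThan_Suc_shift[of "\<lambda>n. (y n)\<^sup>2" L] by simp
  then have "(\<Sum>n<L. (y (Suc n))\<^sup>2) \<le> (\<Sum>n<L. (y n)\<^sup>2)"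
    using yL by (smt (verit) power_zero_numeral zero_le_power2)
  then have "q * (\<Sum>n<L. (y (Suc n))\<^sup>2) \<le> q * (\<Sum>n<L. (y n)\<^sup>2)"
    using q by simp
  with 1 have "(1 - q) * (\<Sum>n<L. (y n)\<^sup>2) \<le> (\<Sum>n<L. (b n)\<^sup>2) / (1 - q)"
    by (simp add: algebra_simps)
  then have "(\<Sum>n<L. (y n)\<^sup>2) \<le> (\<Sum>n<L. (b n)\<^sup>2) / (1 - q) / (1 - q)"
    using q by (subst pos_le_divide_eq) (simp_all add: mult.commute)
  then show ?thesis
    by (simp add: power2_eq_square)
qed

text \<open>
  Relative to a growing solution \<open>p\<close>, the Wronskian of \<open>x\<close> with \<open>p\<close> obeys a contracting
  recursion from the left and the component of \<open>x\<close> along \<open>p\<close> one from the right.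
\<close>

lemma growing_solution_lower_bound:
  fixes p v R :: "nat \<Rightarrow> real" and x :: "nat \<Rightarrow> complex"
  defines "\<rho> \<equiv> \<lambda>n. sqrt ((p n)\<^sup>2 + (p (Suc n))\<^sup>2)"
    and "f \<equiv> \<lambda>n. x (Suc (Suc n)) + of_real (v n) * x (Suc n) + x n"
  assumes sol: "\<And>n. p (Suc (Suc n)) = - v n * p (Suc n) - p n"
    and v: "\<And>n. \<bar>v n\<bar> \<le> M"
    and pos: "\<And>n. 0 < \<rho> n"
    and R: "\<And>n. \<rho> n \<le> R n" "\<And>n. R n \<le> B * \<rho> n"
    and q: "0 < q" "q < 1" "\<And>n. R n \<le> q * R (Suc n)"
    and x: "x 0 = 0" "x (Suc 0) = 0" "\<And>n. n \<ge> L \<Longrightarrow> x n = 0"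
  shows "(\<Sum>n<L. (cmod (x n))\<^sup>2)
    \<le> (4 * (B\<^sup>2 * (2 + M))\<^sup>2 / (1 - q)^4 + 4 * B\<^sup>2 / (1 - q)\<^sup>2 + 2 * B\<^sup>2 / (1 - q)\<^sup>2)
        * (\<Sum>n<L. (cmod (f n))\<^sup>2)"
proof -
  \<comment> \<open>Coordinates of the pair \<open>(x n, x (Suc n))\<close> in the orthogonal basis
    \<open>(p n, p (Suc n))\<close>, \<open>(- p (Suc n), p n)\<close>: \<alpha> is the first
    coefficient, \<open>Wr\<close> divided by the squared length of the basis vectors the
    second.\<close>
  define Wr where "Wr = (\<lambda>n. of_real (p n) * x (Suc n) - of_real (p (Suc n)) * x n)"
  define \<alpha> where "\<alpha> = (\<lambda>n. (of_real (p n) * x n + of_real (p (Suc n)) * x (Suc n)) / of_real ((\<rho> n)\<^sup>2))"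
  \<comment> \<open>Where \<open>f\<close> vanishes \<open>Wr\<close> is constant, so division by a
    growing weight contracts it forwards; multiplying \<alpha> by the weight contracts it backwards.
    \<open>R\<close> stands in for \<rho>, which need not grow at every single step.\<close>
  define a where "a = (\<lambda>n. cmod (Wr n) / R n)"
  define y where "y = (\<lambda>n. R n * cmod (\<alpha> n))"
  define F where "F = (\<Sum>n<L. (cmod (f n))\<^sup>2)"
  have Rpos: "0 < R n" for n using pos R(1) by (rule less_le_trans)
  have "0 \<le> M" using v[of 0] by simp
  have "0 < B * \<rho> 0" using Rpos R(2) by (rule less_le_trans)
  then have B: "0 < B" using pos[of 0] by (simp add: zero_less_mult_iff)
  have rho2: "(\<rho> n)\<^sup>2 = (p n)\<^sup>2 + (p (Suc n))\<^sup>2" for n by (simp add: \<rho>_def)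
  have p_le: "\<bar>p n\<bar> \<le> \<rho> n" "\<bar>p (Suc n)\<bar> \<le> \<rho> n" for n
    by (simp_all add: \<rho>_def real_le_rsqrt)
  have rho2c: "(of_real (\<rho> n))\<^sup>2 = (of_real (p n))\<^sup>2 + (of_real (p (Suc n)) :: complex)\<^sup>2" for n
    unfolding of_real_power[symmetric] rho2 by simp
  have rho_ne: "(of_real (\<rho> n) :: complex) \<noteq> 0" for n using pos[of n] by simp
  have solc: "of_real (p (Suc (Suc n))) = - of_real (v n) * of_real (p (Suc n)) - (of_real (p n) :: complex)" for n
    by (simp add: sol)
  have \<alpha>mult: "\<alpha> n * (of_real (\<rho> n))\<^sup>2 = of_real (p n) * x n + of_real (p (Suc n)) * x (Suc n)" for n
    using rho_ne[of n] by (simp add: \<alpha>_def)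
  have x0: "x n = of_real (p n) * \<alpha> n - of_real (p (Suc n)) * Wr n / (of_real (\<rho> n))\<^sup>2" for n
  proof -
    have "x n * (of_real (\<rho> n))\<^sup>2 = of_real (p n) * (\<alpha> n * (of_real (\<rho> n))\<^sup>2) - of_real (p (Suc n)) * Wr n"
      unfolding \<alpha>mult unfolding rho2c Wr_def by (simp add: algebra_simps power2_eq_square)
    then show ?thesis using rho_ne[of n] by (simp add: field_simps)
  qed
  have x1: "x (Suc n) = of_real (p (Suc n)) * \<alpha> n + of_real (p n) * Wr n / (of_real (\<rho> n))\<^sup>2" for n
  proof -
    have "x (Suc n) * (of_real (\<rho> n))\<^sup>2 = of_real (p (Suc n)) * (\<alpha> n * (of_real (\<rho> n))\<^sup>2) + of_real (p n) * Wr n"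
      unfolding \<alpha>mult unfolding rho2c Wr_def by (simp add: algebra_simps power2_eq_square)
    then show ?thesis using rho_ne[of n] by (simp add: field_simps)
  qed
  have WrS: "Wr (Suc n) = Wr n + of_real (p (Suc n)) * f n" for n
    unfolding Wr_def f_def solc by (simp add: algebra_simps)
  have aS: "a (Suc n) \<le> q * a n + cmod (f n)" for n
  proof -
    have "cmod (Wr (Suc n)) \<le> cmod (Wr n) + \<bar>p (Suc n)\<bar> * cmod (f n)"
      unfolding WrS by (rule order_trans[OF norm_triangle_ineq]) (simp add: norm_mult)
    also have "\<dots> \<le> q * R (Suc n) * a n + R (Suc n) * cmod (f n)"
    proof (rule add_mono)
      have "cmod (Wr n) = R n * a n" using Rpos[of n] by (simp add: a_def)
      also have "\<dots> \<le> q * R (Suc n) * a n"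
        using q(3)[of n] Rpos[of n] by (intro mult_right_mono) (simp_all add: a_def)
      finally show "cmod (Wr n) \<le> q * R (Suc n) * a n" .
      show "\<bar>p (Suc n)\<bar> * cmod (f n) \<le> R (Suc n) * cmod (f n)"
        using order_trans[OF p_le(1) R(1)] by (intro mult_right_mono) simp_all
    qed
    finally show ?thesis using Rpos[of "Suc n"] by (simp add: a_def field_simps)
  qed
  \<comment> \<open>The terms in \<open>\<alpha> n\<close> cancel because \<open>p\<close> solves
    the homogeneous recursion, so \<alpha> moves only through \<open>Wr n\<close> and
    \<open>f n\<close>.\<close>
  have \<alpha>S: "(\<alpha> (Suc n) - \<alpha> n) * (of_real (\<rho> (Suc n)))\<^sup>2 =
      (of_real (p (Suc n)) * of_real (p n) + of_real (p (Suc (Suc n))) * (of_real (p (Suc n)) - of_real (v n) * of_real (p n)))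
        * (Wr n / (of_real (\<rho> n))\<^sup>2) + of_real (p (Suc (Suc n))) * f n" for n
  proof -
    have x2: "x (Suc (Suc n)) = f n + of_real (p (Suc (Suc n))) * \<alpha> n
        + (of_real (p (Suc n)) - of_real (v n) * of_real (p n)) * (Wr n / (of_real (\<rho> n))\<^sup>2)"
    proof -
      have "x (Suc (Suc n)) = f n - of_real (v n) * x (Suc n) - x n"
        by (simp add: f_def)
      also have "\<dots> = f n + of_real (p (Suc (Suc n))) * \<alpha> n
        + (of_real (p (Suc n)) - of_real (v n) * of_real (p n)) * (Wr n / (of_real (\<rho> n))\<^sup>2)"
        unfolding solc x1[of n] by (subst x0[of n]) (simp add: algebra_simps)
      finally show ?thesis .
    qed
    have "(\<alpha> (Suc n) - \<alpha> n) * (of_real (\<rho> (Suc n)))\<^sup>2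
      = of_real (p (Suc n)) * x (Suc n) + of_real (p (Suc (Suc n))) * x (Suc (Suc n)) - \<alpha> n * (of_real (\<rho> (Suc n)))\<^sup>2"
      by (simp add: left_diff_distrib \<alpha>mult)
    also have "\<dots> = (of_real (p (Suc n)) * of_real (p n) + of_real (p (Suc (Suc n))) * (of_real (p (Suc n)) - of_real (v n) * of_real (p n)))
        * (Wr n / (of_real (\<rho> n))\<^sup>2) + of_real (p (Suc (Suc n))) * f n"
      unfolding x2 x1[of n] rho2c[of "Suc n"] by (simp add: algebra_simps power2_eq_square)
    finally show ?thesis .
  qed
  have yS: "y n \<le> q * y (Suc n) + (B\<^sup>2 * (2 + M) * a n + B * cmod (f n))" for n
  proof -
    let ?c = "p (Suc n) * p n + p (Suc (Suc n)) * (p (Suc n) - v n * p n)"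
    have "\<bar>p (Suc n) - v n * p n\<bar> \<le> \<bar>p (Suc n)\<bar> + \<bar>v n * p n\<bar>" by simp
    also have "\<dots> \<le> \<rho> n + M * \<rho> n"
      unfolding abs_mult using v[of n] p_le[of n] \<open>0 \<le> M\<close> by (intro add_mono mult_mono) auto
    finally have 1: "\<bar>p (Suc n) - v n * p n\<bar> \<le> \<rho> n + M * \<rho> n" .
    have "\<bar>?c\<bar> \<le> \<bar>p (Suc n)\<bar> * \<bar>p n\<bar> + \<bar>p (Suc (Suc n))\<bar> * \<bar>p (Suc n) - v n * p n\<bar>"
      unfolding abs_mult[symmetric] by (rule abs_triangle_ineq)
    also have "\<dots> \<le> \<rho> (Suc n) * \<rho> n + \<rho> (Suc n) * (\<rho> n + M * \<rho> n)"
      using p_le[of n] p_le[of "Suc n"] 1 pos[of "Suc n"] by (intro add_mono mult_mono) auto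
    finally have c: "\<bar>?c\<bar> \<le> \<rho> (Suc n) * ((2 + M) * \<rho> n)" by (simp add: algebra_simps)
    have eq: "(\<alpha> (Suc n) - \<alpha> n) * (of_real (\<rho> (Suc n)))\<^sup>2
      = of_real ?c * (Wr n / (of_real (\<rho> n))\<^sup>2) + of_real (p (Suc (Suc n))) * f n"
      unfolding \<alpha>S by simp
    have "cmod (\<alpha> (Suc n) - \<alpha> n) * (\<rho> (Suc n))\<^sup>2 = cmod ((\<alpha> (Suc n) - \<alpha> n) * (of_real (\<rho> (Suc n)))\<^sup>2)"
      by (simp add: norm_mult norm_power)
    also have "\<dots> \<le> \<bar>?c\<bar> * (cmod (Wr n) / (\<rho> n)\<^sup>2) + \<bar>p (Suc (Suc n))\<bar> * cmod (f n)"
      unfolding eq by (rule order_trans[OF norm_triangle_ineq])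
        (simp only: norm_mult norm_divide norm_power norm_of_real power2_abs order_refl)
    also have "\<dots> \<le> \<rho> (Suc n) * ((2 + M) * \<rho> n) * (cmod (Wr n) / (\<rho> n)\<^sup>2) + \<rho> (Suc n) * cmod (f n)"
      using c p_le(2)[of "Suc n"] by (intro add_mono mult_right_mono) auto
    also have "\<dots> = \<rho> (Suc n) * ((2 + M) * (cmod (Wr n) / \<rho> n) + cmod (f n))"
      using pos[of n] by (simp add: field_simps power2_eq_square)
    also have "\<dots> \<le> \<rho> (Suc n) * ((2 + M) * (B * a n) + cmod (f n))"
    proof -
      have "cmod (Wr n) / \<rho> n \<le> B * a n"
        using R(2)[of n] pos[of n] Rpos[of n] B mult_left_mono[OF R(2)[of n] norm_ge_zero[of "Wr n"]]
        by (simp add: a_def field_simps)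
      then show ?thesis using pos[of "Suc n"] \<open>0 \<le> M\<close> by (intro mult_left_mono add_mono) auto
    qed
    finally have "\<rho> (Suc n) * (\<rho> (Suc n) * cmod (\<alpha> (Suc n) - \<alpha> n)) \<le> \<rho> (Suc n) * ((2 + M) * (B * a n) + cmod (f n))"
      by (simp add: power2_eq_square mult_ac)
    then have 2: "\<rho> (Suc n) * cmod (\<alpha> (Suc n) - \<alpha> n) \<le> (2 + M) * (B * a n) + cmod (f n)"
      using pos[of "Suc n"] by (simp only: mult_le_cancel_left_pos)
    have "cmod (\<alpha> n) \<le> cmod (\<alpha> (Suc n)) + cmod (\<alpha> (Suc n) - \<alpha> n)"
      by (metis norm_minus_commute norm_triangle_sub)
    then have "y n \<le> R n * (cmod (\<alpha> (Suc n)) + cmod (\<alpha> (Suc n) - \<alpha> n))"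
      unfolding y_def using Rpos[of n] by simp
    also have "\<dots> \<le> q * R (Suc n) * cmod (\<alpha> (Suc n)) + B * \<rho> (Suc n) * cmod (\<alpha> (Suc n) - \<alpha> n)"
    proof -
      have "R n \<le> B * \<rho> (Suc n)"
        using q(3)[of n] R(2)[of "Suc n"] mult_right_mono[of q 1 "R (Suc n)"] q Rpos[of "Suc n"] by linarith
      then show ?thesis unfolding distrib_left using q(3)[of n] by (intro add_mono mult_right_mono) auto
    qed
    also have "\<dots> \<le> q * y (Suc n) + B * ((2 + M) * (B * a n) + cmod (f n))"
      using mult_left_mono[OF 2, of B] B by (simp add: y_def mult_ac)
    finally show ?thesis by (simp add: algebra_simps power2_eq_square)
  qed
  have "Wr 0 = 0" by (simp add: Wr_def x)
  then have sa: "(\<Sum>n<L. (a n)\<^sup>2) \<le> F / (1 - q)\<^sup>2"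
    unfolding F_def using less_imp_le[OF Rpos]
    by (intro forward_recursion_l2[where a = a, OF q(1,2)] aS) (simp_all add: a_def)
  define G where "G = (2 * (B\<^sup>2 * (2 + M))\<^sup>2 / (1 - q)\<^sup>2 + 2 * B\<^sup>2) * F"
  have sy: "(\<Sum>n<L. (y n)\<^sup>2) \<le> G / (1 - q)\<^sup>2"
  proof -
    have "y L = 0" by (simp add: y_def \<alpha>_def x)
    then have "(\<Sum>n<L. (y n)\<^sup>2) \<le> (\<Sum>n<L. (B\<^sup>2 * (2 + M) * a n + B * cmod (f n))\<^sup>2) / (1 - q)\<^sup>2"
      using less_imp_le[OF Rpos]
      by (intro backward_recursion_l2[where y = y, OF q(1,2)] yS) (simp_all add: y_def)
    also have "(\<Sum>n<L. (B\<^sup>2 * (2 + M) * a n + B * cmod (f n))\<^sup>2)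
        \<le> (\<Sum>n<L. 2 * (B\<^sup>2 * (2 + M))\<^sup>2 * (a n)\<^sup>2 + 2 * B\<^sup>2 * (cmod (f n))\<^sup>2)"
    proof (rule sum_mono)
      fix n
      show "(B\<^sup>2 * (2 + M) * a n + B * cmod (f n))\<^sup>2 \<le> 2 * (B\<^sup>2 * (2 + M))\<^sup>2 * (a n)\<^sup>2 + 2 * B\<^sup>2 * (cmod (f n))\<^sup>2"
        using sum_squares_bound[of "B\<^sup>2 * (2 + M) * a n" "B * cmod (f n)"]
        unfolding power2_sum power_mult_distrib by linarith
    qed
    also have "\<dots> = 2 * (B\<^sup>2 * (2 + M))\<^sup>2 * (\<Sum>n<L. (a n)\<^sup>2) + 2 * B\<^sup>2 * F"
      by (simp add: sum.distrib sum_distrib_left F_def)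
    also have "\<dots> \<le> 2 * (B\<^sup>2 * (2 + M))\<^sup>2 * (F / (1 - q)\<^sup>2) + 2 * B\<^sup>2 * F"
      using sa by (intro add_right_mono mult_left_mono) auto
    also have "\<dots> = G" by (simp add: G_def algebra_simps)
    finally show ?thesis by (simp add: divide_right_mono)
  qed
  have xS: "(cmod (x (Suc n)))\<^sup>2 \<le> 2 * (y n)\<^sup>2 + 2 * B\<^sup>2 * (a n)\<^sup>2" for n
  proof -
    have "cmod (x (Suc n)) \<le> \<bar>p (Suc n)\<bar> * cmod (\<alpha> n) + \<bar>p n\<bar> * cmod (Wr n) / (\<rho> n)\<^sup>2"
      by (subst x1) (rule order_trans[OF norm_triangle_ineq], simp add: norm_mult norm_divide norm_power)
    also have "\<dots> \<le> y n + \<rho> n * cmod (Wr n) / (\<rho> n)\<^sup>2"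
      unfolding y_def using p_le[of n] R(1)[of n] by (intro add_mono mult_right_mono divide_right_mono) auto
    also have "\<rho> n * cmod (Wr n) / (\<rho> n)\<^sup>2 = cmod (Wr n) / \<rho> n"
      using pos[of n] by (simp add: power2_eq_square)
    also have "\<dots> \<le> B * a n"
      using R(2)[of n] pos[of n] Rpos[of n] B mult_left_mono[OF R(2)[of n] norm_ge_zero[of "Wr n"]]
      by (simp add: a_def field_simps)
    finally have "(cmod (x (Suc n)))\<^sup>2 \<le> (y n + B * a n)\<^sup>2"
      by (intro power_mono) auto
    also have "\<dots> \<le> 2 * (y n)\<^sup>2 + 2 * B\<^sup>2 * (a n)\<^sup>2"
      using sum_squares_bound[of "y n" "B * a n"] unfolding power2_sum power_mult_distrib by linarith
    finally show ?thesis .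
  qed
  have "(\<Sum>n<L. (cmod (x n))\<^sup>2) \<le> (\<Sum>n<Suc L. (cmod (x n))\<^sup>2)" by simp
  also have "\<dots> = (\<Sum>n<L. (cmod (x (Suc n)))\<^sup>2)"
    by (simp add: sum.lessThan_Suc_shift x(1) del: sum.lessThan_Suc)
  also have "\<dots> \<le> (\<Sum>n<L. 2 * (y n)\<^sup>2 + 2 * B\<^sup>2 * (a n)\<^sup>2)"
    by (intro sum_mono xS)
  also have "\<dots> = 2 * (\<Sum>n<L. (y n)\<^sup>2) + 2 * B\<^sup>2 * (\<Sum>n<L. (a n)\<^sup>2)"
    by (simp add: sum.distrib sum_distrib_left)
  also have "\<dots> \<le> 2 * (G / (1 - q)\<^sup>2) + 2 * B\<^sup>2 * (F / (1 - q)\<^sup>2)"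
    using sa sy by (intro add_mono mult_left_mono) auto
  also have "\<dots> = (4 * (B\<^sup>2 * (2 + M))\<^sup>2 / (1 - q)^4 + 4 * B\<^sup>2 / (1 - q)\<^sup>2 + 2 * B\<^sup>2 / (1 - q)\<^sup>2) * F"
  proof -
    have "2 * ((2 * K / t + 2 * b) * F / t) + 2 * b * (F / t) = (4 * K / (t * t) + 4 * b / t + 2 * b / t) * F"
      if "t \<noteq> 0" for K b t :: real
      using that by (simp add: field_simps)
    moreover have "(1 - q) ^ 4 = (1 - q)\<^sup>2 * (1 - q)\<^sup>2" by (simp flip: power_add)
    ultimately show ?thesis using q by (simp add: G_def)
  qed
  finally show ?thesis by (simp add: F_def)
qed

section \<open>Forcing growth by random signs\<close>

fun sol :: "(nat \<Rightarrow> real) \<Rightarrow> real \<Rightarrow> real \<Rightarrow> nat \<Rightarrow> real" where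
  "sol w a b 0 = a"
| "sol w a b (Suc 0) = b"
| "sol w a b (Suc (Suc n)) = - w n * sol w a b (Suc n) - sol w a b n"

lemma sol_cong:
  assumes "\<And>i. Suc i < n \<Longrightarrow> w i = w' i"
  shows "sol w a b n = sol w' a b n"
  using assms by (induction n rule: sol.induct[of _ w a b, case_names 0 1 Suc]) auto

lemma sol_shift: "sol w a b (m + n) = sol (\<lambda>i. w (m + i)) (sol w a b m) (sol w a b (Suc m)) n"
proof (induction n rule: less_induct)
  case (less n)
  consider "n = 0" | "n = 1" | k where "n = Suc (Suc k)"
    by (metis One_nat_def not0_implies_Suc)
  then show ?case
    by cases (use less[of "n - 1"] less[of "n - 2"] in auto)
qed

text \<open>
  \<open>second_moments w d a b n\<close> consists of the expectations of
  \<open>s\<^bsub>n+1\<^esub>\<^sup>2\<close>, \<open>s\<^bsub>n+1\<^esub> s\<^bsub>n\<^esub>\<close> and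
  \<open>s\<^bsub>n\<^esub>\<^sup>2\<close> for the solution \<open>s\<close> of the recursion
  whose coefficients are \<open>w\<close> plus independent random signs times \<open>d\<close>.
\<close>

fun second_moments :: "(nat \<Rightarrow> real) \<Rightarrow> real \<Rightarrow> real \<Rightarrow> real \<Rightarrow> nat \<Rightarrow> real \<times> real \<times> real" where
  "second_moments w d a b 0 = (b\<^sup>2, a * b, a\<^sup>2)"
| "second_moments w d a b (Suc n) = (case second_moments w d a b n of
     (x, y, z) \<Rightarrow> ((w n)\<^sup>2 * x + 2 * w n * y + z + d\<^sup>2 * x, - w n * x - y, x))"

text \<open>Some choice of signs does at least as well as the average. The quadratic form is
  arbitrary, and may be negative, because averaging over the newest sign turns it into another form
  one step earlier, to which the induction hypothesis applies.\<close>

lemma exists_perturbation_ge_second_moments: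
  assumes "second_moments w d a b n = (x, y, z)"
  shows "\<exists>w'. (\<forall>i. \<bar>w' i - w i\<bar> \<le> \<bar>d\<bar>) \<and>
    \<alpha> * x + 2 * \<beta> * y + \<gamma> * z \<le> \<alpha> * (sol w' a b (Suc n))\<^sup>2
      + 2 * \<beta> * (sol w' a b (Suc n) * sol w' a b n) + \<gamma> * (sol w' a b n)\<^sup>2"
  using assms
proof (induction n arbitrary: x y z \<alpha> \<beta> \<gamma>)
  case 0
  then show ?case by (intro exI[of _ w]) (auto simp: mult_ac)
next
  case (Suc n)
  obtain x0 y0 z0 where m: "second_moments w d a b n = (x0, y0, z0)"
    by (metis surj_pair)
  \<comment> \<open>Coefficients of the form after averaging over the two values of the newest
    sign.\<close>
  let ?\<alpha> = "\<alpha> * ((w n)\<^sup>2 + d\<^sup>2) - 2 * \<beta> * w n + \<gamma>" and ?\<beta> = "\<alpha> * w n - \<beta>"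
  have xyz: "x = (w n)\<^sup>2 * x0 + 2 * w n * y0 + z0 + d\<^sup>2 * x0" "y = - w n * x0 - y0" "z = x0"
    using Suc.prems m by auto
  obtain w' where w': "\<forall>i. \<bar>w' i - w i\<bar> \<le> \<bar>d\<bar>" and
    le: "?\<alpha> * x0 + 2 * ?\<beta> * y0 + \<alpha> * z0 \<le> ?\<alpha> * (sol w' a b (Suc n))\<^sup>2
      + 2 * ?\<beta> * (sol w' a b (Suc n) * sol w' a b n) + \<alpha> * (sol w' a b n)\<^sup>2"
    using Suc.IH[OF m, of ?\<alpha> ?\<beta> \<alpha>] by blast
  define s t where "s = sol w' a b (Suc n)" and "t = sol w' a b n"
  let ?g = "\<lambda>e. \<alpha> * (- (w n + e) * s - t)\<^sup>2 + 2 * \<beta> * ((- (w n + e) * s - t) * s) + \<gamma> * s\<^sup>2"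
  have "\<alpha> * x + 2 * \<beta> * y + \<gamma> * z = ?\<alpha> * x0 + 2 * ?\<beta> * y0 + \<alpha> * z0"
    unfolding xyz by (simp add: algebra_simps)
  also have "\<dots> \<le> ?\<alpha> * s\<^sup>2 + 2 * ?\<beta> * (s * t) + \<alpha> * t\<^sup>2"
    using le by (simp add: s_def t_def)
  also have "\<dots> = (?g d + ?g (- d)) / 2"
    by (simp add: algebra_simps power2_eq_square)
  finally have "\<alpha> * x + 2 * \<beta> * y + \<gamma> * z \<le> (?g d + ?g (- d)) / 2" .
  moreover have "r \<le> s \<or> r \<le> t" if "r \<le> (s + t) / 2" for r s t :: real
    using that by (rule contrapos_pp) simp
  ultimately have "\<alpha> * x + 2 * \<beta> * y + \<gamma> * z \<le> ?g d \<or> \<alpha> * x + 2 * \<beta> * y + \<gamma> * z \<le> ?g (- d)"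
    by blast
  then obtain e where e: "\<bar>e\<bar> = \<bar>d\<bar>" "\<alpha> * x + 2 * \<beta> * y + \<gamma> * z \<le> ?g e"
    by (metis abs_minus_cancel)
  \<comment> \<open>Coefficient \<open>n\<close> first enters term \<open>n + 2\<close>, so
    overwriting it leaves the two preceding terms unchanged.\<close>
  let ?w = "w'(n := w n + e)"
  have "sol ?w a b (Suc n) = s" "sol ?w a b n = t"
    unfolding s_def t_def by (rule sol_cong; simp)+
  moreover from this have "sol ?w a b (Suc (Suc n)) = - (w n + e) * s - t"
    by simp
  moreover have "\<forall>i. \<bar>?w i - w i\<bar> \<le> \<bar>d\<bar>" using w' e(1) by simp
  ultimately show ?case using e(2) by metis
qed

text \<open>The determinant \<open>D\<close> of the second moment matrix vanishes for deterministic
  initial data. The first two steps make it comparable to the square of \<open>a^2 + b^2\<close>,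
  every further pair of steps multiplies it by at least \<open>1 + 2 * d^2\<close>, and four times
  the determinant is at most the squared trace.\<close>

lemma second_moments_trace_growth:
  assumes m: "second_moments w d a b (2 * k + 2) = (x, y, z)" and M: "\<And>n. \<bar>w n\<bar> \<le> M"
  shows "2 * d\<^sup>2 * (1 + 2 * d\<^sup>2) ^ k / (2 * M\<^sup>2 + 2)\<^sup>2 * (a\<^sup>2 + b\<^sup>2)\<^sup>2 \<le> (x + z)\<^sup>2"
proof -
  define X where "X n = fst (second_moments w d a b n)" for n
  define Y where "Y n = fst (snd (second_moments w d a b n))" for n
  define Z where "Z n = snd (snd (second_moments w d a b n))" for n
  define D where "D n = X n * Z n - (Y n)\<^sup>2" for n
  have rec: "X (Suc n) = (w n)\<^sup>2 * X n + 2 * w n * Y n + Z n + d\<^sup>2 * X n"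
    "Y (Suc n) = - w n * X n - Y n" "Z (Suc n) = X n" for n
    by (simp_all add: X_def Y_def Z_def split_beta)
  have init: "X 0 = b\<^sup>2" "Y 0 = a * b" "Z 0 = a\<^sup>2" by (simp_all add: X_def Y_def Z_def)
  have DS: "D (Suc n) = D n + d\<^sup>2 * (X n)\<^sup>2" for n
    by (simp add: D_def rec algebra_simps power2_eq_square)
  have D0: "D 0 = 0" by (simp add: D_def init power2_eq_square)
  have Dpos: "0 \<le> D n" for n by (induction n) (simp_all add: D0 DS)
  have DX: "D (Suc n) \<le> X (Suc n) * X n" for n by (simp add: D_def rec)
  \<comment> \<open>A single gain may be small, but the product of two consecutive values of
    \<open>X\<close> dominates the determinant, so two consecutive gains together are at least
    \<open>2 * d^2\<close> times it.\<close>
  have DSS: "(1 + 2 * d\<^sup>2) * D n \<le> D (Suc (Suc n))" for n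
  proof -
    have "D n \<le> D (Suc n)" by (simp add: DS)
    then have "2 * D n \<le> 2 * (X (Suc n) * X n)" using DX[of n] by linarith
    also have "\<dots> \<le> (X n)\<^sup>2 + (X (Suc n))\<^sup>2"
      using sum_squares_bound[of "X n" "X (Suc n)"] by (simp add: mult_ac)
    finally have "d\<^sup>2 * (2 * D n) \<le> d\<^sup>2 * ((X n)\<^sup>2 + (X (Suc n))\<^sup>2)"
      by (intro mult_left_mono) auto
    then show ?thesis by (simp add: DS[of "Suc n"] DS[of n] algebra_simps)
  qed
  have Dk: "(1 + 2 * d\<^sup>2) ^ k * D 2 \<le> D (2 * k + 2)" for k
  proof (induction k)
    case (Suc k)
    have "(1 + 2 * d\<^sup>2) ^ Suc k * D 2 \<le> (1 + 2 * d\<^sup>2) * D (2 * k + 2)"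
      using mult_left_mono[OF Suc, of "1 + 2 * d\<^sup>2"] by (simp add: mult_ac)
    also have "\<dots> \<le> D (2 * Suc k + 2)" using DSS[of "2 * k + 2"] by simp
    finally show ?case .
  qed (simp add: numeral_2_eq_2)
  have "a\<^sup>2 + b\<^sup>2 \<le> (2 * M\<^sup>2 + 2) * (X 0 + X 1)"
  proof -
    \<comment> \<open>\<open>X 0\<close> sees only \<open>b\<close>; the entry \<open>a\<close>
      becomes visible in \<open>X 1\<close>. This is why the initial estimate spans two
      steps.\<close>
    have X1: "(w 0 * b + a)\<^sup>2 \<le> X 1"
    proof -
      have "X 1 = (w 0 * b + a)\<^sup>2 + (d * b)\<^sup>2"
        using rec(1)[of 0] by (simp add: init algebra_simps power2_eq_square)
      then show ?thesis by simp
    qed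
    have "a\<^sup>2 \<le> 2 * (w 0 * b + a)\<^sup>2 + 2 * (w 0 * b)\<^sup>2"
      using sum_squares_bound[of "w 0 * b + a" "- (w 0 * b)"] by (simp add: power2_eq_square algebra_simps)
    also have "(w 0 * b)\<^sup>2 \<le> M\<^sup>2 * b\<^sup>2"
      using M[of 0] by (simp add: power_mult_distrib mult_right_mono abs_le_square_iff[symmetric])
    finally have "a\<^sup>2 + b\<^sup>2 \<le> 2 * X 1 + 2 * (M\<^sup>2 * b\<^sup>2) + b\<^sup>2" using X1 by linarith
    moreover have "0 \<le> M\<^sup>2 * X 1" "0 \<le> b\<^sup>2" using order_trans[OF zero_le_power2 X1] by simp_all
    moreover have "(2 * M\<^sup>2 + 2) * (X 0 + X 1)
        = 2 * (M\<^sup>2 * b\<^sup>2) + 2 * b\<^sup>2 + 2 * (M\<^sup>2 * X 1) + 2 * X 1"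
      by (simp add: init algebra_simps)
    ultimately show ?thesis by linarith
  qed
  then have "(a\<^sup>2 + b\<^sup>2)\<^sup>2 \<le> (2 * M\<^sup>2 + 2)\<^sup>2 * (X 0 + X 1)\<^sup>2"
    unfolding power_mult_distrib[symmetric] by (intro power_mono) auto
  also have "\<dots> \<le> (2 * M\<^sup>2 + 2)\<^sup>2 * (2 * ((X 0)\<^sup>2 + (X 1)\<^sup>2))"
    using sum_squares_bound[of "X 0" "X 1"] by (intro mult_left_mono) (auto simp: power2_sum)
  finally have "d\<^sup>2 * (a\<^sup>2 + b\<^sup>2)\<^sup>2 \<le> d\<^sup>2 * ((2 * M\<^sup>2 + 2)\<^sup>2 * (2 * ((X 0)\<^sup>2 + (X 1)\<^sup>2)))"
    by (intro mult_left_mono) auto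
  also have "\<dots> = 2 * (2 * M\<^sup>2 + 2)\<^sup>2 * D 2"
    using DS[of 0] DS[of 1] by (simp add: D0 numeral_2_eq_2 algebra_simps)
  finally have "d\<^sup>2 * (a\<^sup>2 + b\<^sup>2)\<^sup>2 / (2 * M\<^sup>2 + 2)\<^sup>2 \<le> 2 * D 2"
    using Dpos[of 2] by (simp add: divide_le_eq mult_ac)
  then have "(1 + 2 * d\<^sup>2) ^ k * (d\<^sup>2 * (a\<^sup>2 + b\<^sup>2)\<^sup>2 / (2 * M\<^sup>2 + 2)\<^sup>2) \<le> (1 + 2 * d\<^sup>2) ^ k * (2 * D 2)"
    by (intro mult_left_mono) auto
  also have "\<dots> \<le> 2 * D (2 * k + 2)" using Dk[of k] by simp
  finally have "2 * d\<^sup>2 * (1 + 2 * d\<^sup>2) ^ k / (2 * M\<^sup>2 + 2)\<^sup>2 * (a\<^sup>2 + b\<^sup>2)\<^sup>2 \<le> 4 * D (2 * k + 2)"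
    by (simp add: mult_ac)
  also have "\<dots> \<le> (x + z)\<^sup>2"
  proof -
    have "D (2 * k + 2) = x * z - y\<^sup>2" unfolding D_def X_def Y_def Z_def m by simp
    moreover have "4 * (x * z) \<le> (x + z)\<^sup>2"
      using sum_squares_bound[of x z] by (simp add: power2_sum)
    ultimately show ?thesis using zero_le_power2[of y] by linarith
  qed
  finally show ?thesis .
qed

lemma exists_doubling_block:
  assumes "0 < d"
  shows "\<exists>l>0. \<forall>w a b. (\<forall>i. \<bar>w i\<bar> \<le> M) \<longrightarrow> (\<exists>w'. (\<forall>i. \<bar>w' i - w i\<bar> \<le> d) \<and>
    4 * (a\<^sup>2 + b\<^sup>2) \<le> (sol w' a b l)\<^sup>2 + (sol w' a b (Suc l))\<^sup>2)"
proof -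
  define c where "c = 2 * d\<^sup>2 / (2 * M\<^sup>2 + 2)\<^sup>2"
  have "0 < 2 * M\<^sup>2 + 2" by (simp add: add_nonneg_pos)
  then have c: "0 < c" using assms by (simp add: c_def)
  \<comment> \<open>The 16 is the square of the desired factor 4, as growth is known for the squared
    trace. \<open>k\<close> depends on \<open>d\<close> and \<open>M\<close> only, which makes the
    block length uniform in \<open>w\<close>, \<open>a\<close> and \<open>b\<close>.\<close>
  obtain k where k: "16 / c < (1 + 2 * d\<^sup>2) ^ k"
    using real_arch_pow[of "1 + 2 * d\<^sup>2"] assms by auto
  have "\<exists>w'. (\<forall>i. \<bar>w' i - w i\<bar> \<le> d) \<and>
    4 * (a\<^sup>2 + b\<^sup>2) \<le> (sol w' a b (2 * k + 2))\<^sup>2 + (sol w' a b (Suc (2 * k + 2)))\<^sup>2"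
    if M: "\<And>i. \<bar>w i\<bar> \<le> M" for w a b
  proof -
    obtain x y z where m: "second_moments w d a b (2 * k + 2) = (x, y, z)"
      by (metis surj_pair)
    obtain w' where w': "\<forall>i. \<bar>w' i - w i\<bar> \<le> \<bar>d\<bar>"
      "x + z \<le> (sol w' a b (Suc (2 * k + 2)))\<^sup>2 + (sol w' a b (2 * k + 2))\<^sup>2"
      using exists_perturbation_ge_second_moments[OF m, of 1 0 1] by auto
    \<comment> \<open>The growth bound concerns only the square of the trace. Its sign comes from
      the same averaging argument applied to the negated form.\<close>
    have "0 \<le> x + z"
    proof -
      obtain u where "- (x + z) \<le> - ((sol u a b (Suc (2 * k + 2)))\<^sup>2 + (sol u a b (2 * k + 2))\<^sup>2)"
        using exists_perturbation_ge_second_moments[OF m, of "-1" 0 "-1"] by auto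
      then show ?thesis by (smt (verit) zero_le_power2)
    qed
    have "(4 * (a\<^sup>2 + b\<^sup>2))\<^sup>2 = 16 * (a\<^sup>2 + b\<^sup>2)\<^sup>2" by (simp only: power_mult_distrib) simp
    also have "\<dots> \<le> c * (1 + 2 * d\<^sup>2) ^ k * (a\<^sup>2 + b\<^sup>2)\<^sup>2"
      using k c by (intro mult_right_mono) (auto simp: field_simps)
    also have "\<dots> \<le> (x + z)\<^sup>2"
      using second_moments_trace_growth[OF m M] by (simp add: c_def)
    finally have "4 * (a\<^sup>2 + b\<^sup>2) \<le> x + z"
      using \<open>0 \<le> x + z\<close> by (rule power2_le_imp_le)
    with w' assms show ?thesis by (intro exI[of _ w']) auto
  qed
  then show ?thesis by (intro exI[of _ "2 * k + 2"]) auto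
qed

text \<open>The signs of a block are chosen once the pair of values at its start is known, so the
  construction is a recursion on these pairs, with one block length throughout.\<close>

lemma exists_uniformly_growing_perturbation:
  fixes v :: "nat \<Rightarrow> real"
  assumes v: "\<And>n. \<bar>v n\<bar> \<le> M" and "0 < d"
  obtains v' p l where "\<And>n. \<bar>v' n - v n\<bar> \<le> d" "0 < l"
    "\<And>n. p (Suc (Suc n)) = - v' n * p (Suc n) - p n" "p 0 = 1"
    "\<And>k. 4 * ((p (k * l))\<^sup>2 + (p (Suc (k * l)))\<^sup>2) \<le> (p (Suc k * l))\<^sup>2 + (p (Suc (Suc k * l)))\<^sup>2"
proof -
  obtain l where l: "0 < l" and ex: "\<And>w a b. (\<And>i. \<bar>w i\<bar> \<le> M) \<Longrightarrow> \<exists>w'. (\<forall>i. \<bar>w' i - w i\<bar> \<le> d) \<and>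
      4 * (a\<^sup>2 + b\<^sup>2) \<le> (sol w' a b l)\<^sup>2 + (sol w' a b (Suc l))\<^sup>2"
    using exists_doubling_block[OF \<open>0 < d\<close>] by blast
  have "\<exists>w'. (\<forall>i. \<bar>w' i - v (k * l + i)\<bar> \<le> d) \<and>
      4 * (a\<^sup>2 + b\<^sup>2) \<le> (sol w' a b l)\<^sup>2 + (sol w' a b (Suc l))\<^sup>2" for k a b
    using ex[of "\<lambda>i. v (k * l + i)"] v by blast
  then obtain P where P: "\<And>k a b i. \<bar>P k a b i - v (k * l + i)\<bar> \<le> d"
    "\<And>k a b. 4 * (a\<^sup>2 + b\<^sup>2) \<le> (sol (P k a b) a b l)\<^sup>2 + (sol (P k a b) a b (Suc l))\<^sup>2"
    by metis
  define st where "st = rec_nat (1, 0) (\<lambda>k (a, b). (sol (P k a b) a b l, sol (P k a b) a b (Suc l)))"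
  define w where "w k = P k (fst (st k)) (snd (st k))" for k
  have st: "st 0 = (1, 0)" "st (Suc k) = (sol (w k) (fst (st k)) (snd (st k)) l, sol (w k) (fst (st k)) (snd (st k)) (Suc l))" for k
    by (simp_all add: st_def w_def split_beta)
  define v' where "v' n = w (n div l) (n mod l)" for n
  define p where "p = sol v' 1 0"
  \<comment> \<open>Terms up to \<open>Suc l\<close> involve only the coefficients below
    \<open>l\<close>. The pair handed to the next block is thus settled before that block makes its
    own choice.\<close>
  have block: "sol (\<lambda>i. v' (k * l + i)) a b n = sol (w k) a b n" if "n \<le> Suc l" for k a b n
    using that l by (intro sol_cong) (auto simp: v'_def)
  have p_block: "p (k * l + n) = sol (\<lambda>i. v' (k * l + i)) (p (k * l)) (p (Suc (k * l))) n" for k n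
    unfolding p_def by (rule sol_shift)
  have st_p: "st k = (p (k * l), p (Suc (k * l)))" for k
  proof (induction k)
    case 0
    then show ?case by (simp add: st p_def)
  next
    case (Suc k)
    then show ?case
      using p_block[of k l] p_block[of k "Suc l"] block[of l k] block[of "Suc l" k]
      by (simp add: st(2) add.commute del: sol.simps)
  qed
  show ?thesis
  proof
    show "\<bar>v' n - v n\<bar> \<le> d" for n
      using P(1)[of "n div l" _ _ "n mod l"] by (simp add: v'_def w_def)
    show "p (Suc (Suc n)) = - v' n * p (Suc n) - p n" for n
      by (simp add: p_def)
    show "4 * ((p (k * l))\<^sup>2 + (p (Suc (k * l)))\<^sup>2) \<le> (p (Suc k * l))\<^sup>2 + (p (Suc (Suc k * l)))\<^sup>2" for k
      using P(2)[of "p (k * l)" "p (Suc (k * l))" k] st_p[of "Suc k"] st_p[of k]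
      by (simp add: st(2) w_def del: sol.simps mult_Suc)
  qed (simp_all add: l p_def)
qed

text \<open>Growth is guaranteed only from block to block. Inside a block the transfer matrices and
  their inverses are bounded, so \<rho> is equivalent to a weight that grows at every site.\<close>

lemma half_line_perturbation_lower_bound:
  fixes v :: "nat \<Rightarrow> real"
  assumes v: "\<And>n. \<bar>v n\<bar> \<le> M" and "0 < d"
  obtains v' C where "\<And>n. \<bar>v' n - v n\<bar> \<le> d"
    "\<And>(x :: nat \<Rightarrow> complex) L. x 0 = 0 \<Longrightarrow> x (Suc 0) = 0 \<Longrightarrow> (\<And>n. n \<ge> L \<Longrightarrow> x n = 0) \<Longrightarrow>
      (\<Sum>n<L. (cmod (x n))\<^sup>2) \<le> C * (\<Sum>n<L. (cmod (x (Suc (Suc n)) + of_real (v' n) * x (Suc n) + x n))\<^sup>2)"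
proof -
  obtain v' p l where v': "\<And>n. \<bar>v' n - v n\<bar> \<le> d" and l: "0 < l"
    and sol: "\<And>n. p (Suc (Suc n)) = - v' n * p (Suc n) - p n" and p0: "p 0 = 1"
    and grow: "\<And>k. 4 * ((p (k * l))\<^sup>2 + (p (Suc (k * l)))\<^sup>2) \<le> (p (Suc k * l))\<^sup>2 + (p (Suc (Suc k * l)))\<^sup>2"
    by (rule exists_uniformly_growing_perturbation[of v, OF v \<open>0 < d\<close>]) blast
  define M' where "M' = M + d"
  have M': "\<bar>v' n\<bar> \<le> M'" for n using v'[of n] v[of n] by (simp add: M'_def)
  then have "0 \<le> M'" using abs_ge_zero[of "v' 0"] by (meson order_trans)
  define \<rho> where "\<rho> n = sqrt ((p n)\<^sup>2 + (p (Suc n))\<^sup>2)" for n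
  define K where "K = 2 + M'"
  have K: "1 \<le> K" using \<open>0 \<le> M'\<close> by (simp add: K_def)
  have p_le: "\<bar>p n\<bar> \<le> \<rho> n" "\<bar>p (Suc n)\<bar> \<le> \<rho> n" for n
    by (simp_all add: \<rho>_def real_le_rsqrt)
  have rho_le: "\<rho> n \<le> \<bar>p n\<bar> + \<bar>p (Suc n)\<bar>" for n
    unfolding \<rho>_def by (rule sqrt_sum_squares_le_sum_abs)
  have vp: "\<bar>v' n * p (Suc n)\<bar> \<le> M' * \<bar>p (Suc n)\<bar>" for n
    unfolding abs_mult using M' by (rule mult_right_mono) simp
  have up: "\<rho> (Suc n) \<le> K * \<rho> n" for n
  proof -
    have "\<rho> (Suc n) \<le> \<bar>p (Suc n)\<bar> + (M' * \<bar>p (Suc n)\<bar> + \<bar>p n\<bar>)"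
      using rho_le[of "Suc n"] vp[of n] by (simp add: sol)
    also have "\<dots> \<le> \<rho> n + (M' * \<rho> n + \<rho> n)"
      using p_le[of n] \<open>0 \<le> M'\<close> by (intro add_mono mult_left_mono) auto
    finally show ?thesis by (simp add: K_def algebra_simps)
  qed
  have down: "\<rho> n \<le> K * \<rho> (Suc n)" for n
  proof -
    have "\<bar>p n\<bar> \<le> M' * \<bar>p (Suc n)\<bar> + \<bar>p (Suc (Suc n))\<bar>"
      using vp[of n] by (simp add: sol)
    then have "\<rho> n \<le> \<bar>p (Suc n)\<bar> + (M' * \<bar>p (Suc n)\<bar> + \<bar>p (Suc (Suc n))\<bar>)"
      using rho_le[of n] by linarith
    also have "\<dots> \<le> \<rho> (Suc n) + (M' * \<rho> (Suc n) + \<rho> (Suc n))"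
      using p_le[of "Suc n"] \<open>0 \<le> M'\<close> by (intro add_mono mult_left_mono) auto
    finally show ?thesis by (simp add: K_def algebra_simps)
  qed
  have pos: "0 < \<rho> n" for n
  proof (induction n)
    case 0
    then show ?case by (simp add: \<rho>_def p0 add_pos_nonneg)
  next
    case (Suc n)
    then have "0 < K * \<rho> (Suc n)" using down by (rule less_le_trans)
    then show ?case using K by (simp add: zero_less_mult_iff)
  qed
  have iter: "\<rho> (m + i) \<le> K ^ i * \<rho> m" "\<rho> m \<le> K ^ i * \<rho> (m + i)" for m i
  proof (induction i)
    case (Suc i)
    {
      case 1
      show ?case using order_trans[OF up[of "m + i"] mult_left_mono[OF Suc(1), of K]] K by (simp add: mult_ac)
    next
      case 2
      show ?case using order_trans[OF Suc(2) mult_left_mono[OF down[of "m + i"], of "K ^ i"]] K by (simp add: mult_ac)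
    }
  qed simp_all
  have iter_l: "\<rho> (m + i) \<le> K ^ l * \<rho> m" "\<rho> m \<le> K ^ l * \<rho> (m + i)" if "i \<le> l" for m i
    using iter[of m i] power_increasing[OF that K] pos[of m] pos[of "m + i"]
    by (meson mult_right_mono less_imp_le order_trans)+
  \<comment> \<open>A factor \<open>r\<close> per site accumulates to 2 per block, the square root
    of the factor 4 available for squared lengths.\<close>
  define r where "r = root l 2"
  have r: "1 < r" "r ^ l = 2" using l by (simp_all add: r_def)
  \<comment> \<open>Geometric interpolation from the value at the start of the block. The factor
    \<open>K ^ l\<close> makes \<open>R\<close> dominate \<rho>; the reverse comparison costs
    another \<open>K ^ l\<close> and a 2, hence \<open>B\<close>.\<close>
  define R where "R n = K ^ l * (r ^ (n mod l) * \<rho> (n div l * l))" for n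
  have rpow: "1 \<le> r ^ i" "r ^ i \<le> 2" if "i \<le> l" for i
    using r power_increasing[OF that, of r] by (auto intro: one_le_power)
  define B where "B = 2 * (K ^ l * K ^ l)"
  have R1: "\<rho> n \<le> R n" for n
  proof -
    have "\<rho> n \<le> K ^ l * \<rho> (n div l * l)"
      using iter_l(1)[of "n mod l" "n div l * l"] l by (simp add: less_imp_le)
    also have "\<dots> \<le> R n"
      using rpow(1)[of "n mod l"] l K pos[of "n div l * l"] mult_right_mono[of 1 "r ^ (n mod l)" "\<rho> (n div l * l)"]
      by (simp add: R_def less_imp_le)
    finally show ?thesis .
  qed
  have R2: "R n \<le> B * \<rho> n" for n
  proof -
    have "r ^ (n mod l) * \<rho> (n div l * l) \<le> 2 * (K ^ l * \<rho> n)"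
      using rpow[of "n mod l"] l iter_l(2)[of "n mod l" "n div l * l"] pos[of "n div l * l"]
      by (intro mult_mono) (simp_all add: less_imp_le)
    then have "R n \<le> K ^ l * (2 * (K ^ l * \<rho> n))"
      unfolding R_def using K by (intro mult_left_mono) auto
    then show ?thesis by (simp add: B_def mult_ac)
  qed
  have Rq: "R n \<le> 1 / r * R (Suc n)" for n
  proof -
    have "r * (r ^ (n mod l) * \<rho> (n div l * l)) \<le> r ^ (Suc n mod l) * \<rho> (Suc n div l * l)"
    proof (cases "Suc (n mod l) = l")
      \<comment> \<open>At a block boundary the accumulated power of \<open>r\<close> is reset, and
        the doubling of \<rho> between block starts pays for it.\<close>
      case True
      then have "Suc n mod l = 0" "Suc n div l = Suc (n div l)"
        by (simp_all add: mod_Suc div_Suc)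
      moreover have "r * r ^ (n mod l) = 2" using r(2) True by (metis power_Suc)
      moreover have "2 * \<rho> (n div l * l) \<le> \<rho> (Suc (n div l) * l)"
      proof -
        have "2 * \<rho> (n div l * l) = sqrt (4 * ((p (n div l * l))\<^sup>2 + (p (Suc (n div l * l)))\<^sup>2))"
          unfolding \<rho>_def real_sqrt_mult by simp
        also have "\<dots> \<le> \<rho> (Suc (n div l) * l)"
          unfolding \<rho>_def by (intro real_sqrt_le_mono grow)
        finally show ?thesis .
      qed
      ultimately show ?thesis by (simp add: mult.assoc[symmetric])
    next
      case False
      then have "Suc n mod l = Suc (n mod l)" "Suc n div l = n div l"
        using l by (simp_all add: mod_Suc div_Suc)
      then show ?thesis by (simp add: mult.assoc)
    qed
    then have "K ^ l * (r * (r ^ (n mod l) * \<rho> (n div l * l))) \<le> R (Suc n)"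
      unfolding R_def using K by (intro mult_left_mono) auto
    then show ?thesis using r(1) by (simp add: R_def field_simps)
  qed
  show ?thesis
  proof (rule that[OF v'])
    fix x :: "nat \<Rightarrow> complex" and L
    assume "x 0 = 0" "x (Suc 0) = 0" "\<And>n. n \<ge> L \<Longrightarrow> x n = 0"
    with r(1) show "(\<Sum>n<L. (cmod (x n))\<^sup>2)
      \<le> (4 * (B\<^sup>2 * (2 + M'))\<^sup>2 / (1 - 1 / r)^4 + 4 * B\<^sup>2 / (1 - 1 / r)\<^sup>2 + 2 * B\<^sup>2 / (1 - 1 / r)\<^sup>2)
          * (\<Sum>n<L. (cmod (x (Suc (Suc n)) + of_real (v' n) * x (Suc n) + x n))\<^sup>2)"
      by (intro growing_solution_lower_bound[where p = p and v = v' and R = R, OF sol M' pos[unfolded \<rho>_def] R1[unfolded \<rho>_def] R2[unfolded \<rho>_def] _ _ Rq])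
        simp_all
  qed
qed

section \<open>Bounded-below normal operators\<close>

lemma norm_diff_scaleR_power2:
  fixes x u :: "'a::real_inner"
  shows "(norm (x - r *\<^sub>R u))\<^sup>2 = (norm x)\<^sup>2 - 2 * (r * (x \<bullet> u)) + r\<^sup>2 * (norm u)\<^sup>2"
proof -
  have "(norm (x - r *\<^sub>R u))\<^sup>2 = x \<bullet> x - r * (x \<bullet> u) - r * (x \<bullet> u) + r * (r * (u \<bullet> u))"
    unfolding power2_norm_eq_inner inner_diff_left inner_diff_right inner_commute[of u x]
      inner_scaleR_left inner_scaleR_right by (simp only: inner_commute right_diff_distrib diff_diff_eq2 diff_add_eq)
  then show ?thesis unfolding power2_norm_eq_inner power2_eq_square[of r] by linarith
qed

text \<open>The composition of \<open>T\<close> with \<open>T'\<close> has a quadratic form between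
  \<open>c^2\<close> and \<open>k^2\<close>, so the identity minus its multiple by
  \<open>1 / k^2\<close> is a contraction. The fixed point of \<open>g\<close> satisfies
  \<open>T (T' x) = y\<close>, which gives surjectivity.\<close>

lemma bounded_below_normal_invertible:
  fixes T T' :: "'a::{real_inner, complete_space} \<Rightarrow> 'a"
  assumes lin: "linear T" "linear T'" and adj: "\<And>x y. T x \<bullet> y = x \<bullet> T' y"
    and normal: "\<And>x. norm (T' x) = norm (T x)" and bd: "\<And>x. norm (T x) \<le> K * norm x"
    and c: "0 < c" "\<And>x. c * norm x \<le> norm (T x)"
  shows "\<exists>R. bounded_linear R \<and> (\<forall>x. R (T x) = x) \<and> (\<forall>x. T (R x) = x)"
proof -
  define k where "k = max c \<bar>K\<bar>"
  have k: "0 < k" "c \<le> k" and bdk: "norm (T x) \<le> k * norm x" for x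
    using c(1) order_trans[OF bd mult_right_mono[of K k "norm x"]] by (auto simp: k_def)
  have surj: "\<exists>x. T x = y" for y
  proof -
    define g where "g x = x - (1 / k\<^sup>2) *\<^sub>R (T (T' x)) + (1 / k\<^sup>2) *\<^sub>R y" for x
    \<comment> \<open>Expanding the squared norm, the cross term gains twice
      \<open>(norm (T x))^2 / k^2\<close> and the quadratic term costs at most once that amount; the
      remaining gain is at least \<open>c^2 / k^2\<close> times \<open>(norm x)^2\<close>.\<close>
    define q where "q = sqrt (1 - c\<^sup>2 / k\<^sup>2)"
    have ck: "0 < c\<^sup>2 / k\<^sup>2" "c\<^sup>2 / k\<^sup>2 \<le> 1"
      using c(1) k by (simp_all add: divide_le_eq power_mono)
    then have q: "0 \<le> q" "q < 1" by (simp_all add: q_def)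
    have "norm (x - (1 / k\<^sup>2) *\<^sub>R T (T' x)) \<le> q * norm x" for x
    proof -
      have inn: "x \<bullet> T (T' x) = (norm (T x))\<^sup>2"
        using adj[of "T' x" x] by (simp add: inner_commute normal power2_norm_eq_inner[symmetric])
      have "norm (T (T' x)) \<le> k * norm (T x)"
        using bdk[of "T' x"] by (simp add: normal)
      then have "(norm (T (T' x)))\<^sup>2 \<le> k\<^sup>2 * (norm (T x))\<^sup>2"
        using power_mono[of _ _ 2] by (fastforce simp: power_mult_distrib)
      then have 1: "(1 / k\<^sup>2)\<^sup>2 * (norm (T (T' x)))\<^sup>2 \<le> (1 / k\<^sup>2) * (norm (T x))\<^sup>2"
        using k(1) by (simp add: field_simps power2_eq_square)
      have "(c * norm x)\<^sup>2 \<le> (norm (T x))\<^sup>2"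
        using c by (intro power_mono) auto
      then have 2: "c\<^sup>2 / k\<^sup>2 * (norm x)\<^sup>2 \<le> (1 / k\<^sup>2) * (norm (T x))\<^sup>2"
        using k(1) by (simp add: power_mult_distrib divide_right_mono)
      have "(norm (x - (1 / k\<^sup>2) *\<^sub>R T (T' x)))\<^sup>2
        = (norm x)\<^sup>2 - 2 * ((1 / k\<^sup>2) * (norm (T x))\<^sup>2) + (1 / k\<^sup>2)\<^sup>2 * (norm (T (T' x)))\<^sup>2"
        by (simp only: norm_diff_scaleR_power2 inn)
      also have "\<dots> \<le> (q * norm x)\<^sup>2"
        using 1 2 ck by (simp add: q_def power_mult_distrib algebra_simps)
      finally show ?thesis using q by (meson mult_nonneg_nonneg norm_ge_zero power2_le_imp_le)
    qed
    moreover have "g x - g x' = (x - x') - (1 / k\<^sup>2) *\<^sub>R T (T' (x - x'))" for x x'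
      by (simp add: g_def linear_diff[OF lin(1)] linear_diff[OF lin(2)] algebra_simps)
    ultimately have "\<forall>x x'. dist (g x) (g x') \<le> q * dist x x'"
      by (simp add: dist_norm)
    from banach_fix_type[OF q this] obtain x where "g x = x" by blast
    then have "(1 / k\<^sup>2) *\<^sub>R (y - T (T' x)) = 0"
      by (simp add: g_def algebra_simps)
    then show ?thesis using k(1) by auto
  qed
  have inj: "x = x'" if "T x = T x'" for x x'
  proof -
    have "c * norm (x - x') \<le> 0" using c(2)[of "x - x'"] that by (simp add: linear_diff[OF lin(1)])
    then show ?thesis using c(1) by (simp add: mult_le_0_iff)
  qed
  define R where "R y = (SOME x. T x = y)" for y
  have TR: "T (R y) = y" for y unfolding R_def by (rule someI_ex) (rule surj)
  have RT: "R (T x) = x" for x by (rule inj) (rule TR)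
  have "bounded_linear R"
  proof (rule bounded_linear_intro[where K = "1 / c"])
    show "R (x + y) = R x + R y" for x y by (rule inj) (simp add: TR linear_add[OF lin(1)])
    show "R (r *\<^sub>R x) = r *\<^sub>R R x" for r x by (rule inj) (simp add: TR linear_scale[OF lin(1)])
    show "norm (R x) \<le> norm x * (1 / c)" for x
      using c(2)[of "R x"] c(1) by (simp add: TR field_simps)
  qed
  with RT TR show ?thesis by blast
qed

section \<open>The space of square-summable sequences\<close>

lemmas ell2_nth_simps [simp] =
  zero_ell2.rep_eq plus_ell2.rep_eq uminus_ell2.rep_eq minus_ell2.rep_eq scaleR_ell2.rep_eq scaleC_ell2.rep_eq

lemma ell2_eqI: "(\<And>n. ell2_nth \<psi> n = ell2_nth \<phi> n) \<Longrightarrow> \<psi> = \<phi>"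
  by (simp add: ell2_nth_inject[symmetric] fun_eq_iff)

lemma summable_ell2: "(\<lambda>n. (cmod (ell2_nth \<psi> n))\<^sup>2) summable_on S"
proof -
  have "(\<lambda>n. (cmod (ell2_nth \<psi> n))\<^sup>2) summable_on UNIV"
    using ell2_nth[of \<psi>] by (simp add: square_summable_def)
  then show ?thesis by (rule summable_on_subset) simp
qed

lemma norm_ell2_power2: "(norm (\<psi> :: ell2))\<^sup>2 = (\<Sum>\<^sub>\<infinity>n. (cmod (ell2_nth \<psi> n))\<^sup>2)"
  by (simp add: norm_ell2.rep_eq infsum_nonneg)

lemma sum_le_norm_ell2: "finite F \<Longrightarrow> (\<Sum>n\<in>F. (cmod (ell2_nth \<psi> n))\<^sup>2) \<le> (norm \<psi>)\<^sup>2"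
  unfolding norm_ell2_power2 by (rule finite_sum_le_infsum[OF summable_ell2]) auto

lemma cmod_ell2_nth_le: "cmod (ell2_nth \<psi> n) \<le> norm \<psi>"
  using sum_le_norm_ell2[of "{n}" \<psi>] by - (rule power2_le_imp_le, simp_all)

lemma norm_ell2_finite_support:
  assumes "finite S" "\<And>n. n \<notin> S \<Longrightarrow> ell2_nth \<psi> n = 0"
  shows "(norm \<psi>)\<^sup>2 = (\<Sum>n\<in>S. (cmod (ell2_nth \<psi> n))\<^sup>2)"
proof -
  have "(norm \<psi>)\<^sup>2 = (\<Sum>\<^sub>\<infinity>n\<in>S. (cmod (ell2_nth \<psi> n))\<^sup>2)"
    unfolding norm_ell2_power2 by (rule infsum_cong_neutral) (auto simp: assms)
  with assms(1) show ?thesis by simp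
qed

lemma norm_ell2_le:
  assumes "\<And>n. cmod (ell2_nth \<psi> n) \<le> C * cmod (ell2_nth \<phi> n)" "0 \<le> C"
  shows "norm \<psi> \<le> C * norm \<phi>"
proof -
  have "(norm \<psi>)\<^sup>2 \<le> (\<Sum>\<^sub>\<infinity>n. C\<^sup>2 * (cmod (ell2_nth \<phi> n))\<^sup>2)"
    unfolding norm_ell2_power2
    by (intro infsum_mono summable_ell2 summable_on_cmult_right)
      (metis assms(1) norm_ge_zero power_mono power_mult_distrib)
  also have "\<dots> = (C * norm \<phi>)\<^sup>2"
    by (simp add: infsum_cmult_right' norm_ell2_power2 power_mult_distrib)
  finally show ?thesis using assms(2) by - (rule power2_le_imp_le, auto)
qed

lemma norm_scaleC_ell2 [simp]: "norm (c *\<^sub>C \<psi>) = cmod c * norm \<psi>"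
proof -
  have "(norm (c *\<^sub>C \<psi>))\<^sup>2 = (cmod c * norm \<psi>)\<^sup>2"
    by (simp add: norm_ell2_power2 norm_mult power_mult_distrib infsum_cmult_right')
  then show ?thesis by (rule power2_eq_imp_eq) auto
qed

lemma inner_scaleC_ell2: "(c *\<^sub>C \<psi>) \<bullet> \<phi> = \<psi> \<bullet> (cnj c *\<^sub>C \<phi>)"
  by (simp add: inner_ell2.rep_eq inner_complex_def algebra_simps)

lemma scaleC_of_real_ell2 [simp]: "complex_of_real r *\<^sub>C \<psi> = r *\<^sub>R \<psi>"
  by (rule ell2_eqI) (simp add: scaleR_conv_of_real)

lemma scaleC_scaleR_ell2: "c *\<^sub>C (r *\<^sub>R \<psi>) = r *\<^sub>R (c *\<^sub>C \<psi>)"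
  by (rule ell2_eqI) simp

lemma square_summable_of_bounded_sums:
  assumes "\<And>F. finite F \<Longrightarrow> (\<Sum>n\<in>F. (cmod (f n))\<^sup>2) \<le> C\<^sup>2"
  shows "square_summable f" "(\<Sum>\<^sub>\<infinity>n. (cmod (f n))\<^sup>2) \<le> C\<^sup>2"
proof -
  show s: "square_summable f"
    unfolding square_summable_def
    by (rule nonneg_bdd_above_summable_on) (auto intro!: bdd_aboveI[of _ "C\<^sup>2"] assms)
  show "(\<Sum>\<^sub>\<infinity>n. (cmod (f n))\<^sup>2) \<le> C\<^sup>2"
    by (rule infsum_le_finite_sums) (use s assms in \<open>auto simp: square_summable_def\<close>)
qed

text \<open>The limit is taken entrywise, and the Cauchy estimate passes to it on finite sets of
  sites, uniformly in the set. Completeness feeds the fixed point argument for inverses and the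
  compactness argument off the Weyl spectrum.\<close>

instance ell2 :: complete_space
proof
  fix X :: "nat \<Rightarrow> ell2"
  assume X: "Cauchy X"
  have "Cauchy (\<lambda>k. ell2_nth (X k) n)" for n
  proof (rule metric_CauchyI)
    fix e :: real assume "0 < e"
    from metric_CauchyD[OF X this] obtain N where N: "\<And>m k. m \<ge> N \<Longrightarrow> k \<ge> N \<Longrightarrow> dist (X m) (X k) < e" by blast
    have "dist (ell2_nth (X m) n) (ell2_nth (X k) n) < e" if "m \<ge> N" "k \<ge> N" for m k
      using cmod_ell2_nth_le[of "X m - X k" n] N[OF that] by (simp add: dist_norm)
    then show "\<exists>M. \<forall>m\<ge>M. \<forall>k\<ge>M. dist (ell2_nth (X m) n) (ell2_nth (X k) n) < e" by blast
  qed
  then have "\<forall>n. \<exists>l. (\<lambda>k. ell2_nth (X k) n) \<longlonglongrightarrow> l"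
    by (simp add: Cauchy_convergent_iff convergent_def)
  then obtain l where l: "\<And>n. (\<lambda>k. ell2_nth (X k) n) \<longlonglongrightarrow> l n" by metis
  have bound: "\<exists>N. \<forall>m\<ge>N. \<forall>F. finite F \<longrightarrow> (\<Sum>n\<in>F. (cmod (ell2_nth (X m) n - l n))\<^sup>2) \<le> e\<^sup>2" if "0 < e" for e
  proof -
    from metric_CauchyD[OF X that] obtain N where N: "\<And>m k. m \<ge> N \<Longrightarrow> k \<ge> N \<Longrightarrow> dist (X m) (X k) < e" by blast
    have "(\<Sum>n\<in>F. (cmod (ell2_nth (X m) n - l n))\<^sup>2) \<le> e\<^sup>2" if "m \<ge> N" "finite F" for m F
    proof (rule LIMSEQ_le_const2)
      show "(\<lambda>k. \<Sum>n\<in>F. (cmod (ell2_nth (X m) n - ell2_nth (X k) n))\<^sup>2)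
        \<longlonglongrightarrow> (\<Sum>n\<in>F. (cmod (ell2_nth (X m) n - l n))\<^sup>2)"
        by (intro tendsto_intros l)
      have "(\<Sum>n\<in>F. (cmod (ell2_nth (X m) n - ell2_nth (X k) n))\<^sup>2) \<le> e\<^sup>2" if "k \<ge> N" for k
      proof -
        have "(\<Sum>n\<in>F. (cmod (ell2_nth (X m) n - ell2_nth (X k) n))\<^sup>2) \<le> (norm (X m - X k))\<^sup>2"
          using sum_le_norm_ell2[OF \<open>finite F\<close>, of "X m - X k"] by simp
        also have "\<dots> \<le> e\<^sup>2"
          using N[OF \<open>m \<ge> N\<close> that] by (intro power_mono) (simp_all add: dist_norm)
        finally show ?thesis .
      qed
      then show "\<exists>N. \<forall>k\<ge>N. (\<Sum>n\<in>F. (cmod (ell2_nth (X m) n - ell2_nth (X k) n))\<^sup>2) \<le> e\<^sup>2" by blast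
    qed
    then show ?thesis by blast
  qed
  have "square_summable l"
  proof -
    obtain m where "\<And>F. finite F \<Longrightarrow> (\<Sum>n\<in>F. (cmod (ell2_nth (X m) n - l n))\<^sup>2) \<le> 1\<^sup>2"
      using bound[of 1] by auto
    then have "square_summable (\<lambda>n. ell2_nth (X m) n - l n)"
      by (rule square_summable_of_bounded_sums)
    then have "square_summable (\<lambda>n. ell2_nth (X m) n + (- 1) * (ell2_nth (X m) n - l n))"
      using ell2_nth[of "X m"]
      by (intro square_summable_add square_summable_bounded_mult[where C = 1]) auto
    then show ?thesis by simp
  qed
  then have nth_l: "ell2_nth (Abs_ell2 l) = l" by (simp add: Abs_ell2_inverse)
  have "X \<longlonglongrightarrow> Abs_ell2 l"
  proof (rule LIMSEQ_I)
    fix e :: real assume "0 < e"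
    then obtain N where N: "\<And>m F. m \<ge> N \<Longrightarrow> finite F \<Longrightarrow> (\<Sum>n\<in>F. (cmod (ell2_nth (X m) n - l n))\<^sup>2) \<le> (e / 2)\<^sup>2"
      using bound[of "e / 2"] by auto
    have "norm (X m - Abs_ell2 l) < e" if "m \<ge> N" for m
    proof -
      have "(norm (X m - Abs_ell2 l))\<^sup>2 \<le> (e / 2)\<^sup>2"
        unfolding norm_ell2_power2 using square_summable_of_bounded_sums(2)[OF N[OF that]] by (simp add: nth_l)
      then have "norm (X m - Abs_ell2 l) \<le> e / 2"
        using \<open>0 < e\<close> by - (rule power2_le_imp_le, auto)
      then show ?thesis using \<open>0 < e\<close> by simp
    qed
    then show "\<exists>N. \<forall>m\<ge>N. norm (X m - Abs_ell2 l) < e" by blast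
  qed
  then show "convergent X" by (rule convergentI)
qed

section \<open>Restriction, shift and multiplication operators\<close>

lift_definition restrict_ell2 :: "int set \<Rightarrow> ell2 \<Rightarrow> ell2" is "\<lambda>S \<psi> n. if n \<in> S then \<psi> n else 0"
proof -
  fix S :: "int set" and \<psi> :: "int \<Rightarrow> complex"
  assume "square_summable \<psi>"
  then have "square_summable (\<lambda>n. of_bool (n \<in> S) * \<psi> n)"
    by (rule square_summable_bounded_mult[where C = 1]) simp
  moreover have "(\<lambda>n. of_bool (n \<in> S) * \<psi> n) = (\<lambda>n. if n \<in> S then \<psi> n else 0)"
    by auto
  ultimately show "square_summable (\<lambda>n. if n \<in> S then \<psi> n else 0)"
    by simp
qed

lift_definition shift_ell2 :: "int \<Rightarrow> ell2 \<Rightarrow> ell2" is "\<lambda>k \<psi> n. \<psi> (n + k)"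
  by (rule square_summable_shift)

lift_definition mult_ell2 :: "potential \<Rightarrow> ell2 \<Rightarrow> ell2" is
  "\<lambda>(V :: potential) \<psi> n. complex_of_real (apply_bcontfun V n) * \<psi> n"
  using norm_bounded square_summable_bounded_mult by (metis norm_of_real real_norm_def)

lemmas [simp] = restrict_ell2.rep_eq shift_ell2.rep_eq mult_ell2.rep_eq schroedinger.rep_eq

lemma schroedinger_eq: "schroedinger V \<psi> = shift_ell2 1 \<psi> + shift_ell2 (-1) \<psi> + mult_ell2 V \<psi>"
  by (rule ell2_eqI) simp

lemma norm_shift_ell2 [simp]: "norm (shift_ell2 k \<psi>) = norm \<psi>"
proof -
  have "bij_betw (\<lambda>n::int. n + k) UNIV UNIV"
    by (rule bij_betw_byWitness[where f' = "\<lambda>n. n - k"]) auto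
  from infsum_reindex_bij_betw[OF this, of "\<lambda>n. (cmod (ell2_nth \<psi> n))\<^sup>2"]
  have "(norm (shift_ell2 k \<psi>))\<^sup>2 = (norm \<psi>)\<^sup>2" by (simp add: norm_ell2_power2)
  then show ?thesis by (rule power2_eq_imp_eq) auto
qed

lemma norm_mult_ell2_le: "norm (mult_ell2 V \<psi>) \<le> norm V * norm \<psi>"
  using norm_bounded[of V] by (intro norm_ell2_le) (auto simp: norm_mult mult_right_mono)

lemma inner_shift_ell2: "shift_ell2 k \<psi> \<bullet> \<phi> = \<psi> \<bullet> shift_ell2 (- k) \<phi>"
proof -
  have "bij_betw (\<lambda>n::int. n + k) UNIV UNIV"
    by (rule bij_betw_byWitness[where f' = "\<lambda>n. n - k"]) auto
  from infsum_reindex_bij_betw[OF this, of "\<lambda>n. ell2_nth \<psi> n \<bullet> ell2_nth \<phi> (n - k)"]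
  show ?thesis by (simp add: inner_ell2.rep_eq)
qed

lemma inner_mult_ell2: "mult_ell2 V \<psi> \<bullet> \<phi> = \<psi> \<bullet> mult_ell2 V \<phi>"
  by (simp add: inner_ell2.rep_eq inner_complex_def algebra_simps)

lemma inner_schroedinger: "schroedinger V \<psi> \<bullet> \<phi> = \<psi> \<bullet> schroedinger V \<phi>"
  using inner_shift_ell2[of 1 \<psi> \<phi>] inner_shift_ell2[of "-1" \<psi> \<phi>]
  by (simp add: schroedinger_eq inner_add_left inner_add_right inner_mult_ell2)

lemma linear_schroedinger: "linear (schroedinger V)"
  by (intro linearI ell2_eqI) (simp_all add: algebra_simps)

lemma schroedinger_scaleC: "schroedinger V (c *\<^sub>C \<psi>) = c *\<^sub>C schroedinger V \<psi>"
  by (rule ell2_eqI) (simp add: algebra_simps)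

lemma norm_schroedinger_le: "norm (schroedinger V \<psi>) \<le> (2 + norm V) * norm \<psi>"
  unfolding schroedinger_eq
  using norm_triangle_ineq[of "shift_ell2 1 \<psi>" "shift_ell2 (-1) \<psi>"] norm_mult_ell2_le[of V \<psi>]
  by (intro norm_triangle_le) (simp add: distrib_right)

lemma norm_ell2_restrict_split:
  "(norm \<psi>)\<^sup>2 = (norm (restrict_ell2 S \<psi>))\<^sup>2 + (norm (restrict_ell2 (- S) \<psi>))\<^sup>2"
proof -
  have "(norm \<psi>)\<^sup>2 = (\<Sum>\<^sub>\<infinity>n. (cmod (ell2_nth (restrict_ell2 S \<psi>) n))\<^sup>2 + (cmod (ell2_nth (restrict_ell2 (- S) \<psi>) n))\<^sup>2)"
    unfolding norm_ell2_power2 by (intro infsum_cong) auto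
  also have "\<dots> = (norm (restrict_ell2 S \<psi>))\<^sup>2 + (norm (restrict_ell2 (- S) \<psi>))\<^sup>2"
    unfolding norm_ell2_power2 by (intro infsum_add summable_ell2)
  finally show ?thesis .
qed

lemma minus_restrict_ell2: "\<psi> - restrict_ell2 S \<psi> = restrict_ell2 (- S) \<psi>"
  by (rule ell2_eqI) simp

lemma restrict_ell2_tendsto: "(\<lambda>L. restrict_ell2 {- int L..int L} \<psi>) \<longlonglongrightarrow> \<psi>"
proof (rule LIMSEQ_I)
  fix e :: real assume e: "0 < e"
  obtain F where F: "finite F" and approx: "dist (\<Sum>n\<in>F. (cmod (ell2_nth \<psi> n))\<^sup>2) ((norm \<psi>)\<^sup>2) \<le> (e / 2)\<^sup>2"
    using infsum_finite_approximation[OF summable_ell2[of \<psi> UNIV], of "(e / 2)\<^sup>2"] e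
    unfolding norm_ell2_power2 by auto
  define N where "N = nat (Max (insert 0 (abs ` F)))"
  have FN: "F \<subseteq> {- int L..int L}" if "L \<ge> N" for L
  proof
    fix n assume "n \<in> F"
    then have "\<bar>n\<bar> \<le> Max (insert 0 (abs ` F))" using F by (intro Max_ge) auto
    also have "\<dots> \<le> int L" using that by (simp add: N_def)
    finally show "n \<in> {- int L..int L}" by auto
  qed
  have "norm (restrict_ell2 {- int L..int L} \<psi> - \<psi>) < e" if "L \<ge> N" for L
  proof -
    let ?S = "{- int L..int L}"
    have "(\<Sum>n\<in>F. (cmod (ell2_nth \<psi> n))\<^sup>2) \<le> (\<Sum>n\<in>?S. (cmod (ell2_nth \<psi> n))\<^sup>2)"
      using FN[OF that] by (intro sum_mono2) auto
    also have "\<dots> = (norm (restrict_ell2 ?S \<psi>))\<^sup>2"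
      by (subst norm_ell2_finite_support[of ?S]) auto
    finally have "(norm (restrict_ell2 (- ?S) \<psi>))\<^sup>2 \<le> (e / 2)\<^sup>2"
      using approx norm_ell2_restrict_split[of \<psi> ?S] by (simp add: dist_real_def)
    then have "norm (restrict_ell2 (- ?S) \<psi>) \<le> e / 2"
      using e by - (rule power2_le_imp_le, auto)
    moreover have "norm (restrict_ell2 ?S \<psi> - \<psi>) = norm (restrict_ell2 (- ?S) \<psi>)"
      by (simp add: norm_minus_commute minus_restrict_ell2)
    ultimately show ?thesis using e by simp
  qed
  then show "\<exists>N. \<forall>L\<ge>N. norm (restrict_ell2 {- int L..int L} \<psi> - \<psi>) < e" by blast
qed

section \<open>The Weyl spectrum\<close>

definition far :: "nat \<Rightarrow> ell2 set" where
  "far N = {\<psi>. \<forall>n. \<bar>n\<bar> \<le> int N \<longrightarrow> ell2_nth \<psi> n = 0}"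

definition schr :: "potential \<Rightarrow> real \<Rightarrow> ell2 \<Rightarrow> ell2" where
  "schr V E \<psi> = schroedinger V \<psi> - E *\<^sub>R \<psi>"

text \<open>Weyl's criterion, with weakly null sequences replaced by vectors supported outside
  arbitrarily large windows. The strict inequality excludes \<psi> = 0.\<close>

definition weyl_spectrum :: "potential \<Rightarrow> real set" where
  "weyl_spectrum V = {E. \<forall>c>0. \<forall>N. \<exists>\<psi>\<in>far N. norm (schr V E \<psi>) < c * norm \<psi>}"

lemma not_in_weyl_spectrum:
  "E \<notin> weyl_spectrum V \<longleftrightarrow> (\<exists>c>0. \<exists>N. \<forall>\<psi>\<in>far N. c * norm \<psi> \<le> norm (schr V E \<psi>))"
  by (auto simp: weyl_spectrum_def not_less)

lemma far_antimono: "M \<le> N \<Longrightarrow> far N \<subseteq> far M"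
  by (auto simp: far_def)

lemma far_diff: "\<psi> \<in> far N \<Longrightarrow> \<phi> \<in> far N \<Longrightarrow> \<psi> - \<phi> \<in> far N"
  by (simp add: far_def)

lemma far_scaleR: "\<psi> \<in> far N \<Longrightarrow> r *\<^sub>R \<psi> \<in> far N"
  by (simp add: far_def)

lemma restrict_far: "\<psi> \<in> far N \<Longrightarrow> restrict_ell2 S \<psi> \<in> far N"
  by (simp add: far_def)

lemma ell2_nth_schr: "ell2_nth (schr V E \<psi>) n =
    ell2_nth \<psi> (n + 1) + ell2_nth \<psi> (n - 1) + of_real (V n - E) * ell2_nth \<psi> n"
  by (simp add: schr_def scaleR_conv_of_real algebra_simps)

lemma linear_schr: "linear (schr V E)"
  unfolding schr_def
  by (intro linear_compose_sub linear_schroedinger linear_scaleR)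

lemmas schr_diff = linear_diff[OF linear_schr]
  and schr_scaleR = linear_scale[OF linear_schr]

lemma norm_schr_le: "norm (schr V E \<psi>) \<le> (2 + norm V + \<bar>E\<bar>) * norm \<psi>"
  unfolding schr_def
  by (rule norm_triangle_le_diff) (use norm_schroedinger_le[of V \<psi>] in \<open>simp add: algebra_simps\<close>)

lemma bounded_linear_schr: "bounded_linear (schr V E)"
  by (rule bounded_linear_intro[where K = "2 + norm V + \<bar>E\<bar>"])
    (simp_all add: linear_add[OF linear_schr] schr_scaleR norm_schr_le mult.commute[of "norm _"])

lemma inner_schr: "schr V E \<psi> \<bullet> \<phi> = \<psi> \<bullet> schr V E \<phi>"
  by (simp add: schr_def inner_diff_left inner_diff_right inner_schroedinger)

lemma schr_far:
  assumes "\<psi> \<in> far (Suc N)"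
  shows "schr V E \<psi> \<in> far N"
  using assms by (auto simp: far_def ell2_nth_schr)

lemma norm_schr_perturb:
  "norm (schr V' E' \<psi>) \<le> norm (schr V E \<psi>) + (norm (V' - V) + \<bar>E' - E\<bar>) * norm \<psi>"
proof -
  have "schr V' E' \<psi> = schr V E \<psi> + (mult_ell2 (V' - V) \<psi> - (E' - E) *\<^sub>R \<psi>)"
    by (rule ell2_eqI) (simp add: ell2_nth_schr scaleR_conv_of_real algebra_simps)
  then have "norm (schr V' E' \<psi>) \<le> norm (schr V E \<psi>) + norm (mult_ell2 (V' - V) \<psi> - (E' - E) *\<^sub>R \<psi>)"
    by (simp add: norm_triangle_ineq)
  also have "norm (mult_ell2 (V' - V) \<psi> - (E' - E) *\<^sub>R \<psi>) \<le> norm (V' - V) * norm \<psi> + \<bar>E' - E\<bar> * norm \<psi>"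
    by (rule norm_triangle_le_diff) (simp add: norm_mult_ell2_le)
  finally show ?thesis by (simp add: algebra_simps)
qed

text \<open>A lower bound on far vectors loses at most half of its constant. Moving \<open>V\<close>
  and \<open>E\<close> jointly serves two ends: the Weyl spectrum is closed, and avoiding a given
  energy is an open condition on the potential.\<close>

lemma not_in_weyl_spectrum_perturb:
  assumes "E \<notin> weyl_spectrum V"
  shows "\<exists>e>0. \<forall>V' E'. norm (V' - V) + \<bar>E' - E\<bar> \<le> e \<longrightarrow> E' \<notin> weyl_spectrum V'"
proof -
  obtain c N where c: "0 < c" "\<And>\<psi>. \<psi> \<in> far N \<Longrightarrow> c * norm \<psi> \<le> norm (schr V E \<psi>)"
    using assms by (auto simp: not_in_weyl_spectrum)
  have "E' \<notin> weyl_spectrum V'" if "norm (V' - V) + \<bar>E' - E\<bar> \<le> c / 2" for V' E'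
  proof -
    have "c / 2 * norm \<psi> \<le> norm (schr V' E' \<psi>)" if \<psi>: "\<psi> \<in> far N" for \<psi>
    proof -
      have "c * norm \<psi> \<le> norm (schr V' E' \<psi>) + (norm (V' - V) + \<bar>E' - E\<bar>) * norm \<psi>"
        using c(2)[OF \<psi>] norm_schr_perturb[of V E \<psi> V' E'] by (simp add: norm_minus_commute abs_minus_commute)
      also have "\<dots> \<le> norm (schr V' E' \<psi>) + c / 2 * norm \<psi>"
        using that by (intro add_left_mono mult_right_mono \<open>_ \<le> c / 2\<close>) auto
      finally show ?thesis by simp
    qed
    then show ?thesis unfolding not_in_weyl_spectrum using c(1) by (metis half_gt_zero)
  qed
  then show ?thesis using c(1) by (metis half_gt_zero)
qed

lemma compact_weyl_spectrum: "compact (weyl_spectrum V)"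
proof (rule compact_eq_bounded_closed[THEN iffD2, OF conjI])
  have "\<bar>E\<bar> \<le> 2 + norm V" if E: "E \<in> weyl_spectrum V" for E
  proof (rule ccontr)
    assume "\<not> \<bar>E\<bar> \<le> 2 + norm V"
    then have "0 < \<bar>E\<bar> - (2 + norm V)" by simp
    then obtain \<psi> where "norm (schr V E \<psi>) < (\<bar>E\<bar> - (2 + norm V)) * norm \<psi>"
      using E unfolding weyl_spectrum_def by blast
    moreover have "\<bar>E\<bar> * norm \<psi> \<le> norm (schr V E \<psi>) + norm (schroedinger V \<psi>)"
      unfolding schr_def using norm_triangle_ineq4[of "schroedinger V \<psi>" "schroedinger V \<psi> - E *\<^sub>R \<psi>"] by simp
    ultimately show False
      using norm_schroedinger_le[of V \<psi>] by (simp add: algebra_simps)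
  qed
  then show "bounded (weyl_spectrum V)"
    by (auto simp: bounded_iff)
  show "closed (weyl_spectrum V)"
    unfolding closed_def open_dist
  proof safe
    fix E assume "E \<notin> weyl_spectrum V"
    from not_in_weyl_spectrum_perturb[OF this] obtain e where "0 < e"
      and e: "\<And>E'. \<bar>E' - E\<bar> \<le> e \<Longrightarrow> E' \<notin> weyl_spectrum V"
      by fastforce
    then show "\<exists>e>0. \<forall>y. dist y E < e \<longrightarrow> y \<in> - weyl_spectrum V"
      by (intro exI[of _ e]) (auto simp: dist_real_def)
  qed
qed

section \<open>Essential spectrum and Weyl spectrum\<close>

text \<open>The operator minus \<open>z\<close> commutes with its adjoint, which is the same
  expression at \<open>cnj z\<close>. Being normal, it has a bounded inverse as soon as it is
  bounded below, so every spectral point is an approximate eigenvalue.\<close>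

lemma resolvent_set_schroedinger:
  "z \<in> resolvent_set (schroedinger V) \<longleftrightarrow> (\<exists>c>0. \<forall>\<psi>. c * norm \<psi> \<le> norm (schroedinger V \<psi> - z *\<^sub>C \<psi>))"
proof safe
  assume "z \<in> resolvent_set (schroedinger V)"
  then obtain R where R: "bounded_linear R" "\<And>\<psi>. R (schroedinger V \<psi> - z *\<^sub>C \<psi>) = \<psi>"
    by (auto simp: resolvent_set_def)
  obtain K where K: "0 < K" "\<And>\<psi>. norm (R \<psi>) \<le> norm \<psi> * K"
    using bounded_linear.pos_bounded[OF R(1)] by auto
  have "1 / K * norm \<psi> \<le> norm (schroedinger V \<psi> - z *\<^sub>C \<psi>)" for \<psi>
    using K(2)[of "schroedinger V \<psi> - z *\<^sub>C \<psi>"] K(1) by (simp add: R(2) field_simps)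
  then show "\<exists>c>0. \<forall>\<psi>. c * norm \<psi> \<le> norm (schroedinger V \<psi> - z *\<^sub>C \<psi>)"
    using K(1) by (intro exI[of _ "1 / K"]) auto
next
  fix c :: real
  assume c: "0 < c" "\<forall>\<psi>. c * norm \<psi> \<le> norm (schroedinger V \<psi> - z *\<^sub>C \<psi>)"
  define T where "T z \<psi> = schroedinger V \<psi> - z *\<^sub>C \<psi>" for z \<psi>
  have lin: "linear (T z)" for z
    unfolding T_def by (intro linear_compose_sub linear_schroedinger linearI)
      (simp_all add: complex_ell2.scale_right_distrib scaleC_scaleR_ell2)
  have adj: "T z \<psi> \<bullet> \<phi> = \<psi> \<bullet> T (cnj z) \<phi>" for z \<psi> \<phi>
    by (simp add: T_def inner_diff_left inner_diff_right inner_schroedinger inner_scaleC_ell2)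
  have comm: "T (cnj z) (T z \<psi>) = T z (T (cnj z) \<psi>)" for z \<psi>
    by (simp add: T_def linear_diff[OF linear_schroedinger] schroedinger_scaleC
        complex_ell2.scale_right_diff_distrib mult.commute)
  have normal: "norm (T (cnj z) \<psi>) = norm (T z \<psi>)" for \<psi>
  proof -
    have "(norm (T (cnj z) \<psi>))\<^sup>2 = (norm (T z \<psi>))\<^sup>2"
      unfolding power2_norm_eq_inner adj by (simp add: comm)
    then show ?thesis by (rule power2_eq_imp_eq) auto
  qed
  have bd: "norm (T z \<psi>) \<le> (2 + norm V + cmod z) * norm \<psi>" for \<psi>
    unfolding T_def
    by (rule norm_triangle_le_diff) (use norm_schroedinger_le[of V \<psi>] in \<open>simp add: algebra_simps\<close>)
  show "z \<in> resolvent_set (schroedinger V)"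
    using bounded_below_normal_invertible[OF lin lin adj normal bd c(1)] c(2)
    by (simp add: resolvent_set_def T_def)
qed

text \<open>\<open>schr V (Re z)\<close> is symmetric and commutes with multiplication by
  \<open>\<i>\<close>, which is skew for the real inner product. Hence it sends \<psi> to a vector
  orthogonal to \<open>\<i>\<close> times \<psi>, and Pythagoras gives the lower bound
  \<open>\<bar>Im z\<bar>\<close>.\<close>

lemma spectrum_schroedinger_real:
  assumes "z \<in> spectrum (schroedinger V)"
  shows "z = of_real (Re z)"
proof (rule ccontr)
  assume "z \<noteq> of_real (Re z)"
  then have "Im z \<noteq> 0" by (auto simp: complex_eq_iff)
  have "\<bar>Im z\<bar> * norm \<psi> \<le> norm (schroedinger V \<psi> - z *\<^sub>C \<psi>)" for \<psi>
  proof -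
    have orth: "schr V (Re z) \<psi> \<bullet> (\<i> *\<^sub>C \<psi>) = 0"
    proof -
      have "schr V (Re z) (\<i> *\<^sub>C \<psi>) = \<i> *\<^sub>C schr V (Re z) \<psi>"
        by (simp add: schr_def schroedinger_scaleC complex_ell2.scale_right_diff_distrib scaleC_scaleR_ell2)
      then have "schr V (Re z) \<psi> \<bullet> (\<i> *\<^sub>C \<psi>) = \<psi> \<bullet> (\<i> *\<^sub>C schr V (Re z) \<psi>)"
        by (simp only: inner_schr)
      moreover have "schr V (Re z) \<psi> \<bullet> (\<i> *\<^sub>C \<psi>) = - (\<psi> \<bullet> (\<i> *\<^sub>C schr V (Re z) \<psi>))"
        unfolding inner_commute[of "schr V (Re z) \<psi>" "\<i> *\<^sub>C \<psi>"] inner_scaleC_ell2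
        by (simp add: complex_ell2.scale_minus_left)
      ultimately show ?thesis by simp
    qed
    have "schroedinger V \<psi> - z *\<^sub>C \<psi> = schr V (Re z) \<psi> - Im z *\<^sub>R (\<i> *\<^sub>C \<psi>)"
      by (rule ell2_eqI) (simp add: ell2_nth_schr scaleR_conv_of_real complex_eq_iff algebra_simps)
    then have "(norm (schroedinger V \<psi> - z *\<^sub>C \<psi>))\<^sup>2 = (norm (schr V (Re z) \<psi>))\<^sup>2 + (\<bar>Im z\<bar> * norm \<psi>)\<^sup>2"
      using norm_add_Pythagorean[of "schr V (Re z) \<psi>" "- (Im z *\<^sub>R (\<i> *\<^sub>C \<psi>))"] orth
      by (simp add: orthogonal_def)
    then have "(\<bar>Im z\<bar> * norm \<psi>)\<^sup>2 \<le> (norm (schroedinger V \<psi> - z *\<^sub>C \<psi>))\<^sup>2" by simp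
    then show ?thesis by (rule power2_le_imp_le) simp
  qed
  then have "z \<in> resolvent_set (schroedinger V)"
    unfolding resolvent_set_schroedinger using \<open>Im z \<noteq> 0\<close> by (intro exI[of _ "\<bar>Im z\<bar>"]) auto
  with assms show False by (simp add: spectrum_def)
qed

lemma of_real_in_spectrum_iff:
  "complex_of_real E \<in> spectrum (schroedinger V) \<longleftrightarrow> (\<forall>c>0. \<exists>\<psi>. norm (schr V E \<psi>) < c * norm \<psi>)"
  unfolding spectrum_def Compl_iff resolvent_set_schroedinger scaleC_of_real_ell2 schr_def[symmetric]
  by (simp add: not_le)

lemma weyl_spectrum_subset_spectrum: "of_real ` weyl_spectrum V \<subseteq> spectrum (schroedinger V)"
proof (safe, unfold of_real_in_spectrum_iff)
  fix E assume "E \<in> weyl_spectrum V"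
  then show "\<forall>c>0. \<exists>\<psi>. norm (schr V E \<psi>) < c * norm \<psi>"
    by (auto simp: weyl_spectrum_def)
qed

lemma approximate_unit_eigenvector:
  assumes "complex_of_real E \<in> spectrum (schroedinger V)" "0 < c"
  shows "\<exists>\<psi>. norm \<psi> = 1 \<and> norm (schr V E \<psi>) < c"
proof -
  obtain \<psi> where \<psi>: "norm (schr V E \<psi>) < c * norm \<psi>"
    using assms by (auto simp: of_real_in_spectrum_iff)
  have "0 < c * norm \<psi>" using norm_ge_zero \<psi> by (rule le_less_trans)
  then have "\<psi> \<noteq> 0" by auto
  then have "norm (\<psi> /\<^sub>R norm \<psi>) = 1" "norm (schr V E (\<psi> /\<^sub>R norm \<psi>)) < c"
    using \<psi> by (simp_all add: schr_scaleR divide_inverse_commute[symmetric] pos_divide_less_eq)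
  then show ?thesis by blast
qed

lemma finite_convergent_subsequence:
  fixes X :: "nat \<Rightarrow> 'i \<Rightarrow> 'a::heine_borel"
  assumes "finite S" "\<And>i. i \<in> S \<Longrightarrow> bounded (range (\<lambda>k. X k i))"
  shows "\<exists>r. strict_mono (r :: nat \<Rightarrow> nat) \<and> (\<forall>i\<in>S. convergent (\<lambda>k. X (r k) i))"
  using assms
proof (induction S)
  case empty
  show ?case by (rule exI[of _ id]) (simp add: strict_mono_def)
next
  case (insert i S)
  have "\<exists>r. strict_mono (r :: nat \<Rightarrow> nat) \<and> (\<forall>j\<in>S. convergent (\<lambda>k. X (r k) j))"
    by (rule insert.IH) (rule insert.prems, simp)
  then obtain r where r: "strict_mono (r :: nat \<Rightarrow> nat)" "\<forall>j\<in>S. convergent (\<lambda>k. X (r k) j)"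
    by blast
  have "bounded (range (\<lambda>k. X (r k) i))"
    by (rule bounded_subset[OF insert.prems[of i]]) auto
  from bounded_imp_convergent_subsequence[OF this] obtain l s where
    s: "strict_mono s" "((\<lambda>k. X (r k) i) \<circ> s) \<longlonglongrightarrow> l" by auto
  have "convergent (\<lambda>k. X ((r \<circ> s) k) j)" if "j \<in> insert i S" for j
  proof (cases "j = i")
    case True
    with s(2) show ?thesis by (auto simp: convergent_def o_def)
  next
    case False
    with that r(2) have "convergent (\<lambda>k. X (r k) j)" by auto
    from convergent_subseq_convergent[OF this s(1)] show ?thesis by (simp add: o_def)
  qed
  then show ?case using strict_mono_o[OF r(1) s(1)] by blast
qed

text \<open>
  Off the Weyl spectrum, an approximate eigenvector is controlled by its finitely many entries
  in a window, which gives compactness.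
\<close>

lemma approximate_eigenvectors_convergent_subsequence:
  assumes E: "E \<notin> weyl_spectrum V" and bd: "\<And>k. norm (X k) = 1"
    and lim: "(\<lambda>k. norm (schr V E (X k))) \<longlonglongrightarrow> 0"
  obtains r \<psi> where "strict_mono (r :: nat \<Rightarrow> nat)" "(X \<circ> r) \<longlonglongrightarrow> \<psi>" "norm \<psi> = 1" "schr V E \<psi> = 0"
proof -
  obtain c N where c: "0 < c" "\<And>\<psi>. \<psi> \<in> far N \<Longrightarrow> c * norm \<psi> \<le> norm (schr V E \<psi>)"
    using E by (auto simp: not_in_weyl_spectrum)
  let ?S = "{- int N..int N}"
  define K where "K = 2 + norm V + \<bar>E\<bar>"
  have K: "0 < K" by (simp add: K_def add_pos_nonneg)
  have "bounded (range (\<lambda>k. ell2_nth (X k) n))" for n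
    using cmod_ell2_nth_le[of "X _" n] bd by (auto simp: bounded_iff intro!: exI[of _ 1])
  then obtain r where r: "strict_mono (r :: nat \<Rightarrow> nat)" and conv: "\<And>n. n \<in> ?S \<Longrightarrow> convergent (\<lambda>k. ell2_nth (X (r k)) n)"
    using finite_convergent_subsequence[of ?S "\<lambda>k. ell2_nth (X k)"] by auto
  have window: "\<exists>M. \<forall>j\<ge>M. \<forall>k\<ge>M. norm (restrict_ell2 ?S (X (r j) - X (r k))) \<le> e" if "0 < e" for e
  proof -
    define d where "d = e / sqrt (card ?S)"
    have d: "0 < d" using that by (simp add: d_def)
    have "\<forall>n\<in>?S. \<exists>M. \<forall>j\<ge>M. \<forall>k\<ge>M. dist (ell2_nth (X (r j)) n) (ell2_nth (X (r k)) n) < d"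
      using conv[THEN convergent_Cauchy] d metric_CauchyD by blast
    then obtain M where M: "\<And>n j k. n \<in> ?S \<Longrightarrow> j \<ge> M n \<Longrightarrow> k \<ge> M n \<Longrightarrow> dist (ell2_nth (X (r j)) n) (ell2_nth (X (r k)) n) < d"
      by metis
    have "norm (restrict_ell2 ?S (X (r j) - X (r k))) \<le> e" if "j \<ge> Max (M ` ?S)" "k \<ge> Max (M ` ?S)" for j k
    proof -
      have "(norm (restrict_ell2 ?S (X (r j) - X (r k))))\<^sup>2 = (\<Sum>n\<in>?S. (cmod (ell2_nth (X (r j)) n - ell2_nth (X (r k)) n))\<^sup>2)"
        by (subst norm_ell2_finite_support[of ?S]) auto
      also have "\<dots> \<le> (\<Sum>n\<in>?S. d\<^sup>2)"
      proof (intro sum_mono power_mono)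
        fix n assume n: "n \<in> ?S"
        then have "M n \<le> Max (M ` ?S)" by (intro Max_ge) auto
        then show "cmod (ell2_nth (X (r j)) n - ell2_nth (X (r k)) n) \<le> d"
          using M[OF n, of j k] that by (simp add: dist_norm)
      qed simp
      also have "\<dots> = e\<^sup>2" by (simp add: d_def power_divide)
      finally show ?thesis using \<open>0 < e\<close> by - (rule power2_le_imp_le, auto)
    qed
    then show ?thesis by blast
  qed
  have "Cauchy (X \<circ> r)"
  proof (rule CauchyI)
    fix e :: real assume "0 < e"
    \<comment> \<open>The two residuals, at most \<open>c * (e / 16)\<close> each, and the image of
      the window, at most \<open>c * (e / 4)\<close>, leave \<open>3 * e / 8\<close> outside the
      window; with \<open>d\<close> inside, the total is at most 5/8 of \<open>e\<close>.\<close>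
    define d where "d = e / 4 * min 1 (c / K)"
    have d: "0 < d" "d \<le> e / 4" "K * d \<le> c * (e / 4)"
      using \<open>0 < e\<close> c(1) K by (auto simp: d_def min_def field_simps)
    obtain M where M: "\<And>j k. j \<ge> M \<Longrightarrow> k \<ge> M \<Longrightarrow> norm (restrict_ell2 ?S (X (r j) - X (r k))) \<le> d"
      using window[OF d(1)] by blast
    have "0 < c * (e / 16)" using c(1) \<open>0 < e\<close> by simp
    from LIMSEQ_D[OF lim this] obtain M' where M': "\<And>k. k \<ge> M' \<Longrightarrow> norm (schr V E (X k)) < c * (e / 16)" by auto
    have "norm ((X \<circ> r) j - (X \<circ> r) k) < e" if "j \<ge> max M M'" "k \<ge> max M M'" for j k
    proof -
      let ?d = "X (r j) - X (r k)" and ?w = "restrict_ell2 ?S (X (r j) - X (r k))"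
      have w: "norm ?w \<le> d" using that by (intro M) auto
      have "?d - ?w \<in> far N" unfolding minus_restrict_ell2 by (auto simp: far_def)
      then have "c * norm (?d - ?w) \<le> norm (schr V E (?d - ?w))" by (rule c(2))
      also have "\<dots> \<le> norm (schr V E ?d) + norm (schr V E ?w)"
        unfolding schr_diff[of V E ?d ?w] by (rule norm_triangle_ineq4)
      also have "norm (schr V E ?d) \<le> norm (schr V E (X (r j))) + norm (schr V E (X (r k)))"
        unfolding schr_diff by (rule norm_triangle_ineq4)
      also have "\<dots> \<le> c * (e / 16) + c * (e / 16)"
        using that strict_mono_imp_increasing[OF r] by (intro add_mono less_imp_le[OF M']) (meson max.boundedE le_trans)+
      also have "norm (schr V E ?w) \<le> c * (e / 4)"
      proof -
        have "norm (schr V E ?w) \<le> K * norm ?w" unfolding K_def by (rule norm_schr_le)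
        also have "\<dots> \<le> K * d" using w K by simp
        finally show ?thesis using d(3) by linarith
      qed
      finally have "c * norm (?d - ?w) \<le> c * (3 * e / 8)" by simp
      then have "norm (?d - ?w) \<le> 3 * e / 8" using c(1) by (simp only: mult_le_cancel_left_pos)
      moreover have "norm ?d \<le> norm (?d - ?w) + norm ?w" by (metis diff_add_cancel norm_triangle_ineq)
      ultimately show ?thesis using w d(2) \<open>0 < e\<close> by simp
    qed
    then show "\<exists>M. \<forall>j\<ge>M. \<forall>k\<ge>M. norm ((X \<circ> r) j - (X \<circ> r) k) < e" by blast
  qed
  then obtain \<psi> where \<psi>: "(X \<circ> r) \<longlonglongrightarrow> \<psi>"
    by (auto simp: Cauchy_convergent_iff convergent_def)
  have "norm \<psi> = 1"
    using tendsto_norm[OF \<psi>] by (simp add: bd o_def LIMSEQ_const_iff)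
  moreover have "schr V E \<psi> = 0"
  proof -
    from bounded_linear.tendsto[OF bounded_linear_schr \<psi>] have "(\<lambda>k. norm (schr V E ((X \<circ> r) k))) \<longlonglongrightarrow> norm (schr V E \<psi>)"
      by (rule tendsto_norm)
    moreover have "(\<lambda>k. norm (schr V E ((X \<circ> r) k))) \<longlonglongrightarrow> 0"
      using LIMSEQ_subseq_LIMSEQ[OF lim r] by (simp add: o_def)
    ultimately show ?thesis using LIMSEQ_unique by fastforce
  qed
  ultimately show ?thesis using that r \<psi> by blast
qed

text \<open>A solution of the eigenvalue equation is determined by its entries at \<open>0\<close> and \<open>1\<close>.\<close>

lemma finite_multiplicity_schroedinger: "finite_multiplicity (schroedinger V) z"
proof -
  have det: "\<psi> = 0" if \<psi>: "\<psi> \<in> eigenspace (schroedinger V) z" and "ell2_nth \<psi> 0 = 0" "ell2_nth \<psi> 1 = 0" for \<psi>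
  proof -
    have eq: "ell2_nth \<psi> (n + 1) + ell2_nth \<psi> (n - 1) + of_real (V n) * ell2_nth \<psi> n = z * ell2_nth \<psi> n" for n
      using arg_cong[of _ _ "\<lambda>\<phi>. ell2_nth \<phi> n", OF \<psi>[unfolded eigenspace_def, simplified]] by simp
    have "ell2_nth \<psi> (int k) = 0 \<and> ell2_nth \<psi> (int k + 1) = 0" for k
    proof (induction k)
      case (Suc k)
      then show ?case using eq[of "int k + 1"] by (simp add: add.commute)
    qed (simp add: that)
    moreover have "ell2_nth \<psi> (- int k) = 0 \<and> ell2_nth \<psi> (1 - int k) = 0" for k
    proof (induction k)
      case (Suc k)
      have "- int (Suc k) = - int k - 1" "1 - int (Suc k) = - int k" by simp_all
      moreover have "ell2_nth \<psi> (- int k - 1) = 0" using eq[of "- int k"] Suc by (simp add: add.commute)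
      ultimately show ?case using Suc by metis
    qed (simp add: that)
    ultimately show ?thesis
    proof (intro ell2_eqI)
      fix n show "ell2_nth \<psi> n = ell2_nth 0 n"
        using \<open>\<And>k. ell2_nth \<psi> (int k) = 0 \<and> _ k\<close> \<open>\<And>k. ell2_nth \<psi> (- int k) = 0 \<and> _ k\<close>
        by (cases n rule: int_cases2) simp_all
    qed
  qed
  have sub: "\<psi> - c *\<^sub>C \<phi> \<in> eigenspace (schroedinger V) z"
    if "\<psi> \<in> eigenspace (schroedinger V) z" "\<phi> \<in> eigenspace (schroedinger V) z" for \<psi> \<phi> c
    using that by (simp add: eigenspace_def linear_diff[OF linear_schroedinger] schroedinger_scaleC
        complex_ell2.scale_right_diff_distrib mult.commute)
  let ?S = "eigenspace (schroedinger V) z"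
  \<comment> \<open>Row reduction on the entries at 0 and 1: \<open>a\<close> is nonzero at 0 if
    some solution is, and \<open>b\<close> vanishes at 0 but not at 1 if some solution does.
    Otherwise the zero vector serves.\<close>
  obtain a where a: "a \<in> ?S" "\<And>\<psi>. \<psi> \<in> ?S \<Longrightarrow> \<exists>c. ell2_nth (\<psi> - c *\<^sub>C a) 0 = 0"
  proof (cases "\<exists>a\<in>?S. ell2_nth a 0 \<noteq> 0")
    case True
    then obtain a where "a \<in> ?S" "ell2_nth a 0 \<noteq> 0" by blast
    then show ?thesis
      by (intro that[of a]) (auto intro!: exI[of _ "ell2_nth _ 0 / ell2_nth a 0"])
  next
    case False
    then show ?thesis
      by (intro that[of 0]) (auto simp: eigenspace_def linear_0[OF linear_schroedinger])
  qed
  obtain b where b: "\<And>\<psi>. \<psi> \<in> ?S \<Longrightarrow> ell2_nth \<psi> 0 = 0 \<Longrightarrow> \<exists>c. \<psi> = c *\<^sub>C b"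
  proof (cases "\<exists>b\<in>?S. ell2_nth b 0 = 0 \<and> ell2_nth b 1 \<noteq> 0")
    case True
    then obtain b where b: "b \<in> ?S" "ell2_nth b 0 = 0" "ell2_nth b 1 \<noteq> 0" by blast
    have "\<psi> = (ell2_nth \<psi> 1 / ell2_nth b 1) *\<^sub>C b" if "\<psi> \<in> ?S" "ell2_nth \<psi> 0 = 0" for \<psi>
      using det[OF sub[OF that(1) b(1), of "ell2_nth \<psi> 1 / ell2_nth b 1"]] that b by simp
    then show ?thesis by (intro that[of b]) blast
  next
    case False
    then have "\<psi> = 0 *\<^sub>C 0" if "\<psi> \<in> ?S" "ell2_nth \<psi> 0 = 0" for \<psi>
      using det[OF that(1)] that by auto
    then show ?thesis by (intro that[of 0]) blast
  qed
  have "\<psi> \<in> complex_ell2.span {a, b}" if \<psi>: "\<psi> \<in> ?S" for \<psi>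
  proof -
    obtain c where c: "ell2_nth (\<psi> - c *\<^sub>C a) 0 = 0" using a(2)[OF \<psi>] by blast
    obtain d where "\<psi> - c *\<^sub>C a = d *\<^sub>C b" using b[OF sub[OF \<psi> a(1)] c] by blast
    then have "\<psi> = c *\<^sub>C a + d *\<^sub>C b" by (simp add: algebra_simps)
    then show ?thesis
      by (simp add: complex_ell2.span_add complex_ell2.span_scale complex_ell2.span_base)
  qed
  then show ?thesis
    unfolding finite_multiplicity_def by (intro exI[of _ "{a, b}"]) auto
qed

text \<open>Compactness turns approximate eigenvectors at \<open>E\<close> into an eigenvector. Were
  \<open>E\<close> a limit of other spectral points, approximate eigenvectors at those points would
  be asymptotically orthogonal to each eigenvector at \<open>E\<close>, while a subsequence of them
  converges to a unit one.\<close>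

lemma spectrum_minus_weyl_spectrum:
  assumes spec: "complex_of_real E \<in> spectrum (schroedinger V)" and E: "E \<notin> weyl_spectrum V"
  shows "eigenvalue (schroedinger V) (of_real E)" "complex_of_real E isolated_in spectrum (schroedinger V)"
proof -
  have "\<exists>\<psi>. norm \<psi> = 1 \<and> norm (schr V E \<psi>) < inverse (real (Suc k))" for k
    using approximate_unit_eigenvector[OF spec] by simp
  then obtain X where X: "\<And>k. norm (X k) = 1" "\<And>k. norm (schr V E (X k)) < inverse (real (Suc k))"
    by metis
  have "(\<lambda>k. norm (schr V E (X k))) \<longlonglongrightarrow> 0"
    using X(2) by (intro Lim_null_comparison[OF always_eventually LIMSEQ_inverse_real_of_nat])
      (auto intro: less_imp_le simp del: of_nat_Suc)
  from approximate_eigenvectors_convergent_subsequence[OF E X(1) this] obtain \<psi>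
    where "norm \<psi> = 1" "schr V E \<psi> = 0" by blast
  then show "eigenvalue (schroedinger V) (of_real E)"
    by (auto simp: eigenvalue_def eigenspace_def schr_def intro!: exI[of _ \<psi>])
next
  show "complex_of_real E isolated_in spectrum (schroedinger V)"
  proof (rule ccontr)
    assume "\<not> complex_of_real E isolated_in spectrum (schroedinger V)"
    then have near: "\<exists>y\<in>spectrum (schroedinger V). dist (complex_of_real E) y < e \<and> y \<noteq> of_real E" if "0 < e" for e
      using spec that unfolding isolated_in_dist_Ex_iff by blast
    have "\<exists>x. complex_of_real x \<in> spectrum (schroedinger V) \<and> \<bar>x - E\<bar> < inverse (real (Suc k)) \<and> x \<noteq> E" for k
    proof -
      obtain y where y: "y \<in> spectrum (schroedinger V)" "dist (complex_of_real E) y < inverse (real (Suc k))" "y \<noteq> of_real E"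
        using near[of "inverse (real (Suc k))"] by auto
      with spectrum_schroedinger_real[OF y(1)] show ?thesis
        by (intro exI[of _ "Re y"]) (metis abs_minus_commute dist_of_real dist_real_def)
    qed
    then obtain x where x: "\<And>k. complex_of_real (x k) \<in> spectrum (schroedinger V)"
      "\<And>k. \<bar>x k - E\<bar> < inverse (real (Suc k))" "\<And>k. x k \<noteq> E" by metis
    \<comment> \<open>The error is small relative to \<open>\<bar>x k - E\<bar>\<close>, because the
      orthogonality estimate divides by this distance.\<close>
    have "\<exists>\<psi>. norm \<psi> = 1 \<and> norm (schr V (x k) \<psi>) < \<bar>x k - E\<bar> * inverse (real (Suc k))" for k
      using approximate_unit_eigenvector[OF x(1)] x(3) by simp
    then obtain X where X: "\<And>k. norm (X k) = 1"
      "\<And>k. norm (schr V (x k) (X k)) < \<bar>x k - E\<bar> * inverse (real (Suc k))" by metis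
    have "norm (schr V E (X k)) \<le> 2 * inverse (real (Suc k))" for k
    proof -
      have "norm (schr V E (X k)) \<le> norm (schr V (x k) (X k)) + \<bar>x k - E\<bar>"
        using norm_schr_perturb[of V E "X k" V "x k"] X(1)[of k] by (simp add: abs_minus_commute)
      moreover have "\<bar>x k - E\<bar> * inverse (real (Suc k)) \<le> \<bar>x k - E\<bar> * 1"
        by (intro mult_left_mono) (simp_all add: inverse_le_1_iff)
      ultimately have "norm (schr V E (X k)) \<le> 2 * \<bar>x k - E\<bar>" using X(2)[of k] by simp
      also have "\<dots> \<le> 2 * inverse (real (Suc k))"
        using x(2)[of k] by (intro mult_left_mono) (simp_all del: of_nat_Suc)
      finally show ?thesis .
    qed
    then have lim: "(\<lambda>k. norm (schr V E (X k))) \<longlonglongrightarrow> 0"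
      using tendsto_mult_left[OF LIMSEQ_inverse_real_of_nat, of 2]
      by - (rule Lim_null_comparison[where g = "\<lambda>k. 2 * inverse (real (Suc k))", OF always_eventually],
          simp_all del: of_nat_Suc)
    obtain r \<psi> where r: "strict_mono (r :: nat \<Rightarrow> nat)" and \<psi>: "(X \<circ> r) \<longlonglongrightarrow> \<psi>" "norm \<psi> = 1" "schr V E \<psi> = 0"
      using approximate_eigenvectors_convergent_subsequence[OF E X(1) lim] by blast
    have "\<bar>X k \<bullet> \<psi>\<bar> \<le> inverse (real (Suc k))" for k
    proof -
      have "schr V (x k) \<psi> = schr V E \<psi> - (x k - E) *\<^sub>R \<psi>"
        by (simp add: schr_def algebra_simps)
      then have "schr V (x k) (X k) \<bullet> \<psi> = - ((x k - E) * (X k \<bullet> \<psi>))"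
        unfolding inner_schr \<psi>(3) by simp
      then have "\<bar>x k - E\<bar> * \<bar>X k \<bullet> \<psi>\<bar> \<le> norm (schr V (x k) (X k))"
        using Cauchy_Schwarz_ineq2[of "schr V (x k) (X k)" \<psi>] \<psi>(2) by (simp add: abs_mult)
      also have "\<dots> \<le> \<bar>x k - E\<bar> * inverse (real (Suc k))" using X(2)[of k] by simp
      finally show ?thesis using x(3)[of k] by simp
    qed
    then have "(\<lambda>k. X k \<bullet> \<psi>) \<longlonglongrightarrow> 0"
      by - (rule Lim_null_comparison[OF always_eventually LIMSEQ_inverse_real_of_nat], simp del: of_nat_Suc)
    from LIMSEQ_subseq_LIMSEQ[OF this r] have "(\<lambda>k. (X \<circ> r) k \<bullet> \<psi>) \<longlonglongrightarrow> 0" by (simp add: o_def)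
    moreover have "(\<lambda>k. (X \<circ> r) k \<bullet> \<psi>) \<longlonglongrightarrow> \<psi> \<bullet> \<psi>"
      by (intro tendsto_intros \<psi>(1))
    ultimately have "\<psi> \<bullet> \<psi> = 0" using LIMSEQ_unique by blast
    with \<psi>(2) show False by simp
  qed
qed

lemma essential_spectrum_eq_weyl_spectrum:
  assumes "\<And>E. \<not> E isolated_in weyl_spectrum V"
  shows "essential_spectrum (schroedinger V) = of_real ` weyl_spectrum V"
proof (intro equalityI subsetI)
  fix z assume z: "z \<in> essential_spectrum (schroedinger V)"
  then have "z = of_real (Re z)"
    by (auto simp: essential_spectrum_def intro!: spectrum_schroedinger_real)
  moreover from this have "Re z \<in> weyl_spectrum V"
    using z spectrum_minus_weyl_spectrum[of "Re z" V] finite_multiplicity_schroedinger[of V z]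
    by (auto simp: essential_spectrum_def)
  ultimately show "z \<in> of_real ` weyl_spectrum V" by blast
next
  fix z assume "z \<in> complex_of_real ` weyl_spectrum V"
  then obtain E where E: "z = of_real E" "E \<in> weyl_spectrum V" by blast
  have spec: "\<And>x. x \<in> weyl_spectrum V \<Longrightarrow> complex_of_real x \<in> spectrum (schroedinger V)"
    using weyl_spectrum_subset_spectrum by blast
  have "\<not> complex_of_real E isolated_in spectrum (schroedinger V)"
  proof
    assume "complex_of_real E isolated_in spectrum (schroedinger V)"
    then obtain e where "0 < e" "\<And>y. y \<in> spectrum (schroedinger V) \<Longrightarrow> dist (complex_of_real E) y < e \<Longrightarrow> y = of_real E"
      unfolding isolated_in_dist_Ex_iff by blast
    then have "E isolated_in weyl_spectrum V"
      using spec E(2) unfolding isolated_in_dist_Ex_iff by (metis dist_of_real of_real_eq_iff)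
    with assms show False by blast
  qed
  with E spec show "z \<in> essential_spectrum (schroedinger V)"
    by (simp add: essential_spectrum_def)
qed

section \<open>Perturbation of the Weyl spectrum\<close>

text \<open>Let \<mu> be the limit in \<open>N\<close> of the infimum of
  \<open>(norm (A \<psi>))^2\<close> over unit vectors of \<open>far N\<close>, and \<tau> its
  square root. If neither \<open>E + \<tau>\<close> nor \<open>E - \<tau>\<close> were a Weyl
  energy, \<open>A^2 - \<mu>\<close> would factor into two operators bounded below on far vectors,
  and one gradient step would push the lower bound above \<mu>.\<close>

lemma weyl_spectrum_near_approximate_eigenvalue:
  assumes \<eta>: "0 \<le> \<eta>" and approx: "\<And>N. \<exists>\<psi>\<in>far N. \<psi> \<noteq> 0 \<and> norm (schr V E \<psi>) \<le> \<eta> * norm \<psi>"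
  shows "\<exists>E'\<in>weyl_spectrum V. \<bar>E' - E\<bar> \<le> \<eta>"
proof (rule ccontr)
  assume none: "\<not> ?thesis"
  define A where "A = schr V E"
  define S where "S = {s. 0 \<le> s \<and> (\<exists>N. \<forall>\<psi>\<in>far N. s * (norm \<psi>)\<^sup>2 \<le> (norm (A \<psi>))\<^sup>2)}"
  have le: "s \<le> \<eta>\<^sup>2" if s: "s \<in> S" for s
  proof -
    obtain N where N: "\<And>\<psi>. \<psi> \<in> far N \<Longrightarrow> s * (norm \<psi>)\<^sup>2 \<le> (norm (A \<psi>))\<^sup>2"
      using s by (auto simp: S_def)
    obtain \<psi> where \<psi>: "\<psi> \<in> far N" "\<psi> \<noteq> 0" "norm (A \<psi>) \<le> \<eta> * norm \<psi>"
      using approx[of N] by (auto simp: A_def)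
    have "s * (norm \<psi>)\<^sup>2 \<le> (\<eta> * norm \<psi>)\<^sup>2"
      using N[OF \<psi>(1)] power_mono[OF \<psi>(3), of 2] by simp
    with \<psi>(2) show ?thesis by (simp add: power_mult_distrib)
  qed
  define \<mu> where "\<mu> = Sup S"
  have S0: "0 \<in> S" by (simp add: S_def)
  have bdd: "bdd_above S" using le by (rule bdd_aboveI)
  have \<mu>: "0 \<le> \<mu>" "\<mu> \<le> \<eta>\<^sup>2"
    unfolding \<mu>_def using cSup_upper[OF S0 bdd] cSup_least[of S "\<eta>\<^sup>2"] S0 le by auto
  define \<tau> where "\<tau> = sqrt \<mu>"
  have \<tau>: "0 \<le> \<tau>" "\<tau> \<le> \<eta>" "\<tau>\<^sup>2 = \<mu>"
    using \<mu> \<eta> by (simp_all add: \<tau>_def real_le_lsqrt)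
  then have "E + \<tau> \<notin> weyl_spectrum V" "E - \<tau> \<notin> weyl_spectrum V" using none by auto
  then obtain c1 N1 c2 N2 where c1: "0 < c1" "\<forall>\<psi>\<in>far N1. c1 * norm \<psi> \<le> norm (schr V (E + \<tau>) \<psi>)"
    and c2: "0 < c2" "\<forall>\<psi>\<in>far N2. c2 * norm \<psi> \<le> norm (schr V (E - \<tau>) \<psi>)"
    unfolding not_in_weyl_spectrum by blast
  define c where "c = c1 * c2 / 2"
  have c: "0 < c" using c1 c2 by (simp add: c_def)
  have fac: "2 * c * norm \<psi> \<le> norm (A (A \<psi>) - \<mu> *\<^sub>R \<psi>)" if \<psi>: "\<psi> \<in> far (N1 + N2 + 1)" for \<psi>
  proof -
    have "\<psi> \<in> far N2" "schr V (E - \<tau>) \<psi> \<in> far N1"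
      using far_antimono[of N2 "N1 + N2 + 1"] far_antimono[of "Suc N1" "N1 + N2 + 1"] \<psi> by (auto intro: schr_far)
    then have "c1 * (c2 * norm \<psi>) \<le> norm (schr V (E + \<tau>) (schr V (E - \<tau>) \<psi>))"
      using c1 c2 by (meson less_imp_le mult_left_mono order_trans)
    also have "schr V (E + \<tau>) (schr V (E - \<tau>) \<psi>) = A (A \<psi>) - (\<tau>\<^sup>2) *\<^sub>R \<psi>"
      by (simp add: A_def schr_def linear_diff[OF linear_schroedinger] linear_add[OF linear_schroedinger]
          linear_scale[OF linear_schroedinger] power2_eq_square algebra_simps)
    finally show ?thesis by (simp add: c_def \<tau>(3) mult_ac)
  qed
  define K where "K = 2 + norm V + \<bar>E\<bar>"
  have K: "0 < K" by (simp add: K_def add_pos_nonneg)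
  have AK: "norm (A \<psi>) \<le> K * norm \<psi>" for \<psi> unfolding A_def K_def by (rule norm_schr_le)
  \<comment> \<open>Closeness \<open>c\<close> allows \<mu> to be replaced by \<open>s\<close> at
    the price of half the bound \<open>2 * c\<close>; closeness \<open>c^2 / K^2\<close> makes the
    improved bound exceed \<mu>.\<close>
  define \<epsilon> where "\<epsilon> = min c (c\<^sup>2 / K\<^sup>2)"
  have \<epsilon>: "0 < \<epsilon>" "\<epsilon> \<le> c" "\<epsilon> \<le> c\<^sup>2 / K\<^sup>2" using c K by (simp_all add: \<epsilon>_def)
  obtain s where s: "s \<in> S" "\<mu> - \<epsilon> < s"
    using less_cSup_iff[of S "\<mu> - \<epsilon>"] S0 bdd \<epsilon>(1) by (auto simp: \<mu>_def)
  have s\<mu>: "s \<le> \<mu>" unfolding \<mu>_def using s(1) bdd by (rule cSup_upper)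
  obtain M where M: "\<And>\<psi>. \<psi> \<in> far M \<Longrightarrow> s * (norm \<psi>)\<^sup>2 \<le> (norm (A \<psi>))\<^sup>2" and "0 \<le> s"
    using s(1) by (auto simp: S_def)
  have "(s + c\<^sup>2 / K\<^sup>2) * (norm \<psi>)\<^sup>2 \<le> (norm (A \<psi>))\<^sup>2" if \<psi>: "\<psi> \<in> far (N1 + N2 + M + 2)" for \<psi>
  proof -
    define \<xi> where "\<xi> = A (A \<psi>) - s *\<^sub>R \<psi>"
    have "\<psi> \<in> far (Suc (Suc M))" "\<psi> \<in> far M" "\<psi> \<in> far (N1 + N2 + 1)"
      using \<psi> far_antimono[of "Suc (Suc M)" "N1 + N2 + M + 2"] far_antimono[of M "N1 + N2 + M + 2"]
        far_antimono[of "N1 + N2 + 1" "N1 + N2 + M + 2"] by auto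
    note \<psi>s = this
    have \<xi>: "\<xi> \<in> far M"
      unfolding \<xi>_def A_def by (intro far_diff far_scaleR schr_far \<psi>s)
    have "2 * c * norm \<psi> \<le> norm (\<xi> - (\<mu> - s) *\<^sub>R \<psi>)"
      using fac[OF \<psi>s(3)] by (simp add: \<xi>_def algebra_simps)
    also have "\<dots> \<le> norm \<xi> + (\<mu> - s) * norm \<psi>"
      using norm_triangle_ineq4[of \<xi> "(\<mu> - s) *\<^sub>R \<psi>"] s\<mu> by simp
    also have "\<dots> \<le> norm \<xi> + c * norm \<psi>"
      using s(2) \<epsilon>(2) by (intro add_left_mono mult_right_mono) auto
    finally have "(c * norm \<psi>)\<^sup>2 \<le> (norm \<xi>)\<^sup>2"
      using c by (intro power_mono) auto
    then have 1: "c\<^sup>2 * (norm \<psi>)\<^sup>2 / K\<^sup>2 \<le> (norm \<xi>)\<^sup>2 / K\<^sup>2"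
      by (simp add: power_mult_distrib divide_right_mono)
    \<comment> \<open>Step length of the descent: \<xi> is half the gradient at \<psi> of
      \<open>(norm (A \<psi>))^2 - s * (norm \<psi>)^2\<close>. With this \<open>t\<close> the
      quadratic term uses up at most half of the linear gain. \<psi> starts two sites beyond
      \<open>M\<close> because \<xi> applies \<open>A\<close> twice.\<close>
    define t where "t = 1 / K\<^sup>2"
    have "A (\<psi> - t *\<^sub>R \<xi>) = A \<psi> - t *\<^sub>R A \<xi>"
      by (simp add: A_def schr_diff schr_scaleR)
    with M[OF far_diff[OF \<psi>s(2) far_scaleR[OF \<xi>, of t]]]
    have "s * ((norm \<psi>)\<^sup>2 - 2 * (t * (\<psi> \<bullet> \<xi>)) + t\<^sup>2 * (norm \<xi>)\<^sup>2)
        \<le> (norm (A \<psi>))\<^sup>2 - 2 * (t * (A \<psi> \<bullet> A \<xi>)) + t\<^sup>2 * (norm (A \<xi>))\<^sup>2"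
      by (simp only: norm_diff_scaleR_power2)
    moreover have "A \<psi> \<bullet> A \<xi> = (norm \<xi>)\<^sup>2 + s * (\<psi> \<bullet> \<xi>)"
    proof -
      have "A \<psi> \<bullet> A \<xi> = A (A \<psi>) \<bullet> \<xi>" by (simp add: A_def inner_schr)
      also have "\<dots> = (\<xi> + s *\<^sub>R \<psi>) \<bullet> \<xi>" by (simp add: \<xi>_def)
      finally show ?thesis by (simp add: inner_add_left power2_norm_eq_inner)
    qed
    moreover have "t\<^sup>2 * (norm (A \<xi>))\<^sup>2 \<le> t * (norm \<xi>)\<^sup>2"
    proof -
      have "(norm (A \<xi>))\<^sup>2 \<le> K\<^sup>2 * (norm \<xi>)\<^sup>2"
        unfolding power_mult_distrib[symmetric] using AK[of \<xi>] by (intro power_mono) auto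
      then show ?thesis using K by (simp add: t_def field_simps power2_eq_square)
    qed
    moreover have "0 \<le> s * (t\<^sup>2 * (norm \<xi>)\<^sup>2)" using \<open>0 \<le> s\<close> by simp
    ultimately have "s * (norm \<psi>)\<^sup>2 + t * (norm \<xi>)\<^sup>2 \<le> (norm (A \<psi>))\<^sup>2"
      by (simp add: algebra_simps)
    with 1 show ?thesis by (simp add: t_def algebra_simps)
  qed
  then have "s + c\<^sup>2 / K\<^sup>2 \<in> S" using \<open>0 \<le> s\<close> by (auto simp: S_def)
  then have "s + c\<^sup>2 / K\<^sup>2 \<le> \<mu>" unfolding \<mu>_def using bdd by (rule cSup_upper)
  with s(2) \<epsilon>(3) show False by linarith
qed

lemma open_weyl_spectrum_meets: "open {V. \<exists>E\<in>weyl_spectrum V. a < E \<and> E < b}"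
  unfolding open_dist
proof safe
  fix V E assume E: "E \<in> weyl_spectrum V" "a < E" "E < b"
  \<comment> \<open>One \<open>e\<close> is for the residual and one for the perturbation; the third
    keeps the energy found strictly inside the interval.\<close>
  define e where "e = min (E - a) (b - E) / 3"
  have e: "0 < e" "E - a \<ge> 3 * e" "b - E \<ge> 3 * e" using E by (auto simp: e_def)
  have "\<exists>E'\<in>weyl_spectrum V'. a < E' \<and> E' < b" if "dist V' V < e" for V'
  proof -
    have "\<exists>\<psi>\<in>far N. \<psi> \<noteq> 0 \<and> norm (schr V' E \<psi>) \<le> 2 * e * norm \<psi>" for N
    proof -
      obtain \<psi> where \<psi>: "\<psi> \<in> far N" "norm (schr V E \<psi>) < e * norm \<psi>"
        using E(1) e(1) by (auto simp: weyl_spectrum_def)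
      then have "\<psi> \<noteq> 0" by (auto simp: schr_def linear_0[OF linear_schroedinger])
      have "norm (schr V' E \<psi>) \<le> norm (schr V E \<psi>) + norm (V' - V) * norm \<psi>"
        using norm_schr_perturb[of V' E \<psi> V E] by simp
      also have "\<dots> \<le> e * norm \<psi> + e * norm \<psi>"
        using \<psi>(2) that by (intro add_mono mult_right_mono) (auto simp: dist_norm)
      finally show ?thesis using \<psi>(1) \<open>\<psi> \<noteq> 0\<close> by auto
    qed
    from weyl_spectrum_near_approximate_eigenvalue[OF _ this] e(1)
    obtain E' where "E' \<in> weyl_spectrum V'" "\<bar>E' - E\<bar> \<le> 2 * e" by auto
    with e show ?thesis by (intro bexI[of _ E']) linarith+
  qed
  with e(1) show "\<exists>e>0. \<forall>V'. dist V' V < e \<longrightarrow> V' \<in> {V. \<exists>E\<in>weyl_spectrum V. a < E \<and> E < b}" by blast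
qed

text \<open>The strict inequality survives truncation by continuity. Finite support permits disjoint
  placement of approximate eigenvectors and is what the half-line estimates require.\<close>

lemma weyl_spectrum_finite_support:
  assumes E: "E \<in> weyl_spectrum V" and c: "0 < c"
  shows "\<exists>\<psi>\<in>far N. \<exists>L. (\<forall>n. int L < \<bar>n\<bar> \<longrightarrow> ell2_nth \<psi> n = 0) \<and> norm (schr V E \<psi>) < c * norm \<psi>"
proof -
  obtain \<psi> where \<psi>: "\<psi> \<in> far N" "norm (schr V E \<psi>) < c * norm \<psi>"
    using E c by (auto simp: weyl_spectrum_def)
  let ?r = "\<lambda>L. restrict_ell2 {- int L..int L} \<psi>"
  have "(\<lambda>L. c * norm (?r L) - norm (schr V E (?r L))) \<longlonglongrightarrow> c * norm \<psi> - norm (schr V E \<psi>)"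
    by (intro tendsto_intros bounded_linear.tendsto[OF bounded_linear_schr] restrict_ell2_tendsto)
  moreover have "0 < c * norm \<psi> - norm (schr V E \<psi>)" using \<psi>(2) by simp
  ultimately have "\<forall>\<^sub>F L in sequentially. 0 < c * norm (?r L) - norm (schr V E (?r L))"
    by (rule order_tendstoD)
  then obtain L where "norm (schr V E (?r L)) < c * norm (?r L)"
    by (auto simp: eventually_sequentially)
  with \<psi>(1) show ?thesis by (intro bexI[of _ "?r L"] exI[of _ L]) (auto intro: restrict_far)
qed

section \<open>Explicit perturbations that split or expel an energy\<close>

lemma bounded_function_potential:
  fixes g :: "int \<Rightarrow> real"
  assumes "\<And>n. \<bar>g n\<bar> \<le> C"
  obtains W :: potential where "\<And>n. W n = g n" "norm W \<le> C"
proof -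
  have "g \<in> bcontfun" using assms by (intro bcontfun_normI[where b = C]) auto
  then have "apply_bcontfun (Bcontfun g) = g" by (rule Bcontfun_inverse)
  then show thesis using assms by (intro that[of "Bcontfun g"] norm_bound) auto
qed

text \<open>
  Far-out approximate eigenvectors can be chosen with disjoint supports; shifting the potential
  by \<open>s\<close> on every other support and by \<open>t\<close> elsewhere splits the energy in two.
\<close>

lemma weyl_spectrum_split:
  assumes E: "E \<in> weyl_spectrum V"
  obtains V' where "norm (V' - V) \<le> max \<bar>s\<bar> \<bar>t\<bar>" "E + s \<in> weyl_spectrum V'" "E + t \<in> weyl_spectrum V'"
proof -
  let ?Q = "\<lambda>k N N'. N < N' \<and> (\<exists>\<psi>\<in>far N. (\<forall>n. int N' < \<bar>n\<bar> \<longrightarrow> ell2_nth \<psi> n = 0) \<and>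
      norm (schr V E \<psi>) < inverse (real (Suc k)) * norm \<psi>)"
  have "\<exists>N'. ?Q k N N'" for k N
  proof -
    obtain \<psi> L where \<psi>: "\<psi> \<in> far N" "\<And>n. int L < \<bar>n\<bar> \<Longrightarrow> ell2_nth \<psi> n = 0"
        "norm (schr V E \<psi>) < inverse (real (Suc k)) * norm \<psi>"
      using weyl_spectrum_finite_support[OF E, of "inverse (real (Suc k))" N] by auto
    then show ?thesis by (intro exI[of _ "max L (Suc N)"] conjI bexI[of _ \<psi>]) auto
  qed
  then obtain N where N: "\<And>k. ?Q k (N k) (N (Suc k))"
    using dependent_nat_choice[of "\<lambda>_ _. True" ?Q] by auto
  have mono: "strict_mono N" using N by (simp add: strict_mono_Suc_iff)
  have "\<exists>\<psi>\<in>far (N k). (\<forall>n. int (N (Suc k)) < \<bar>n\<bar> \<longrightarrow> ell2_nth \<psi> n = 0) \<and>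
      norm (schr V E \<psi>) < inverse (real (Suc k)) * norm \<psi>" for k
    using N by blast
  then obtain \<psi> where \<psi>: "\<And>k. \<psi> k \<in> far (N k)" "\<And>k n. int (N (Suc k)) < \<bar>n\<bar> \<Longrightarrow> ell2_nth (\<psi> k) n = 0"
      "\<And>k. norm (schr V E (\<psi> k)) < inverse (real (Suc k)) * norm (\<psi> k)"
    by metis
  define annulus where "annulus k = {n :: int. int (N k) < \<bar>n\<bar> \<and> \<bar>n\<bar> \<le> int (N (Suc k))}" for k
  have disj: "k = k'" if "n \<in> annulus k" "n \<in> annulus k'" for n k k'
  proof -
    have "\<not> k < k'" if "n \<in> annulus k" "n \<in> annulus k'" for k k'
    proof
      assume "k < k'"
      then have "N (Suc k) \<le> N k'" using mono by (simp add: strict_mono_less_eq Suc_leI)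
      with that show False by (auto simp: annulus_def)
    qed
    with that show ?thesis by (meson linorder_neqE_nat)
  qed
  \<comment> \<open>The annuli contain the supports. Sites in no even annulus receive
    \<open>t\<close>, including those near the origin, where every \<open>\<psi> k\<close>
    vanishes.\<close>
  define g where "g n = (if \<exists>k. even k \<and> n \<in> annulus k then s else t)" for n
  obtain W :: potential where W: "\<And>n. W n = g n" "norm W \<le> max \<bar>s\<bar> \<bar>t\<bar>"
    by (rule bounded_function_potential[of g "max \<bar>s\<bar> \<bar>t\<bar>"]) (auto simp: g_def)
  \<comment> \<open>Wherever \<open>\<psi> k\<close> is nonzero the added potential is the constant
    \<open>u\<close>, which the shift of the energy cancels.\<close>
  have same: "schr (V + W) (E + u) (\<psi> k) = schr V E (\<psi> k)" if "u = (if even k then s else t)" for u k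
  proof (rule ell2_eqI)
    fix n
    have "W n = u \<or> ell2_nth (\<psi> k) n = 0"
    proof (cases "n \<in> annulus k")
      case True
      then have "(\<exists>k. even k \<and> n \<in> annulus k) \<longleftrightarrow> even k" using disj by metis
      then show ?thesis by (simp add: W g_def that)
    next
      case False
      then show ?thesis using \<psi>(1)[of k] \<psi>(2)[of k n] by (auto simp: annulus_def far_def not_less)
    qed
    then show "ell2_nth (schr (V + W) (E + u) (\<psi> k)) n = ell2_nth (schr V E (\<psi> k)) n"
      by (auto simp: ell2_nth_schr)
  qed
  have mem: "E + u \<in> weyl_spectrum (V + W)" if u: "\<And>j :: nat. \<exists>k\<ge>j. u = (if even k then s else t)" for u
    unfolding weyl_spectrum_def
  proof (intro CollectI allI impI)
    fix c :: real and M :: nat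
    assume "0 < c"
    then obtain j where j: "inverse (real (Suc j)) < c" using reals_Archimedean by blast
    obtain k where k: "k \<ge> max j M" "u = (if even k then s else t)" using u[of "max j M"] by blast
    have "inverse (real (Suc k)) \<le> inverse (real (Suc j))" using k(1) by (intro le_imp_inverse_le) auto
    from order_trans[OF this less_imp_le[OF j]]
    have "inverse (real (Suc k)) * norm (\<psi> k) \<le> c * norm (\<psi> k)"
      by (rule mult_right_mono) simp
    then have "norm (schr (V + W) (E + u) (\<psi> k)) < c * norm (\<psi> k)"
      using \<psi>(3)[of k] same[OF k(2)] by simp
    moreover have "\<psi> k \<in> far M"
      using \<psi>(1)[of k] far_antimono[of M "N k"] strict_mono_imp_increasing[OF mono, of k] k(1) by auto
    ultimately show "\<exists>\<psi>\<in>far M. norm (schr (V + W) (E + u) \<psi>) < c * norm \<psi>" by blast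
  qed
  show thesis
  proof (rule that)
    show "norm (V + W - V) \<le> max \<bar>s\<bar> \<bar>t\<bar>" using W(2) by simp
    show "E + s \<in> weyl_spectrum (V + W)"
      by (rule mem) (rule_tac x = "2 * j" in exI, simp)
    show "E + t \<in> weyl_spectrum (V + W)"
      by (rule mem) (rule_tac x = "2 * j + 1" in exI, simp)
  qed
qed

text \<open>A vector in \<open>far 1\<close> vanishes at -1, 0 and 1, so it splits into two
  half-line sequences with zero initial data, the left one read by reflection. Their residuals sit
  at disjoint sites, so the two half-line estimates add up.\<close>

lemma exists_perturbation_outside_weyl_spectrum:
  assumes d: "0 < d"
  obtains V' where "norm (V' - V) \<le> d" "E \<notin> weyl_spectrum V'"
proof -
  have bound: "\<bar>V m - E\<bar> \<le> norm V + \<bar>E\<bar>" for m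
    using norm_bounded[of V m] by simp
  obtain vR CR where vR: "\<And>n. \<bar>vR n - (V (int n + 1) - E)\<bar> \<le> d"
    "\<And>(x :: nat \<Rightarrow> complex) L. x 0 = 0 \<Longrightarrow> x (Suc 0) = 0 \<Longrightarrow> (\<And>n. n \<ge> L \<Longrightarrow> x n = 0) \<Longrightarrow>
      (\<Sum>n<L. (cmod (x n))\<^sup>2) \<le> CR * (\<Sum>n<L. (cmod (x (Suc (Suc n)) + of_real (vR n) * x (Suc n) + x n))\<^sup>2)"
    by (rule half_line_perturbation_lower_bound[of "\<lambda>n. V (int n + 1) - E", OF bound d]) blast
  obtain vL CL where vL: "\<And>n. \<bar>vL n - (V (- int n - 1) - E)\<bar> \<le> d"
    "\<And>(x :: nat \<Rightarrow> complex) L. x 0 = 0 \<Longrightarrow> x (Suc 0) = 0 \<Longrightarrow> (\<And>n. n \<ge> L \<Longrightarrow> x n = 0) \<Longrightarrow>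
      (\<Sum>n<L. (cmod (x n))\<^sup>2) \<le> CL * (\<Sum>n<L. (cmod (x (Suc (Suc n)) + of_real (vL n) * x (Suc n) + x n))\<^sup>2)"
    by (rule half_line_perturbation_lower_bound[of "\<lambda>n. V (- int n - 1) - E", OF bound d]) blast
  \<comment> \<open>\<open>vR n\<close> multiplies entry \<open>Suc n\<close> of its sequence and so
    belongs to site \<open>n + 1\<close>; likewise \<open>vL n\<close> belongs to site
    \<open>- n - 1\<close>. The value at 0 is kept.\<close>
  define g where "g n = (if 0 < n then vR (nat (n - 1)) + E - V n
      else if n < 0 then vL (nat (- n - 1)) + E - V n else 0)" for n
  have g: "\<bar>g n\<bar> \<le> d" for n
    using vR(1)[of "nat (n - 1)"] vL(1)[of "nat (- n - 1)"] d by (auto simp: g_def algebra_simps)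
  obtain W :: potential where W: "\<And>n. W n = g n" "norm W \<le> d"
    by (rule bounded_function_potential[of g, OF g]) blast
  have WR: "(V + W) (int n + 1) - E = vR n" for n by (simp add: W g_def)
  have WL: "(V + W) (- int n - 1) - E = vL n" for n by (simp add: W g_def)
  define C where "C = max 1 (max CR CL)"
  have C: "0 < C" "CR \<le> C" "CL \<le> C" by (auto simp: C_def)
  have "E \<notin> weyl_spectrum (V + W)"
  proof
    assume "E \<in> weyl_spectrum (V + W)"
    from weyl_spectrum_finite_support[OF this, of "1 / sqrt C" 1] C(1)
    obtain \<psi> L where \<psi>: "\<psi> \<in> far 1" "\<And>n. int L < \<bar>n\<bar> \<Longrightarrow> ell2_nth \<psi> n = 0"
        "norm (schr (V + W) E \<psi>) < 1 / sqrt C * norm \<psi>" by auto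
    define f where "f n = (cmod (ell2_nth (schr (V + W) E \<psi>) n))\<^sup>2" for n
    define h where "h n = (cmod (ell2_nth \<psi> n))\<^sup>2" for n
    have \<psi>0: "ell2_nth \<psi> 0 = 0" "ell2_nth \<psi> 1 = 0" "ell2_nth \<psi> (- 1) = 0"
      using \<psi>(1) by (simp_all add: far_def)
    have "(\<Sum>n<Suc L. h (int n)) \<le> CR * (\<Sum>n<Suc L. f (int n + 1))"
    proof -
      have "f (int n + 1) = (cmod (ell2_nth \<psi> (int (Suc (Suc n))) + of_real (vR n) * ell2_nth \<psi> (int (Suc n)) + ell2_nth \<psi> (int n)))\<^sup>2" for n
        unfolding f_def ell2_nth_schr WR by (simp add: algebra_simps)
      then show ?thesis
        using vR(2)[of "\<lambda>n. ell2_nth \<psi> (int n)" "Suc L"] \<psi> \<psi>0 by (simp add: h_def del: sum.lessThan_Suc)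
    qed
    also have "\<dots> \<le> C * (\<Sum>n<Suc L. f (int n + 1))"
      using C by (intro mult_right_mono sum_nonneg) (auto simp: f_def)
    finally have R: "(\<Sum>n<Suc L. h (int n)) \<le> C * (\<Sum>n<Suc L. f (int n + 1))" .
    have "(\<Sum>n<Suc L. h (- int n)) \<le> CL * (\<Sum>n<Suc L. f (- int n - 1))"
    proof -
      have "f (- int n - 1) = (cmod (ell2_nth \<psi> (- int (Suc (Suc n))) + of_real (vL n) * ell2_nth \<psi> (- int (Suc n)) + ell2_nth \<psi> (- int n)))\<^sup>2" for n
      proof -
        define m where "m = - int n - 1"
        have m: "- int (Suc (Suc n)) = m - 1" "- int (Suc n) = m" "- int n = m + 1" by (simp_all add: m_def)
        have "f m = (cmod (ell2_nth \<psi> (m - 1) + of_real (vL n) * ell2_nth \<psi> m + ell2_nth \<psi> (m + 1)))\<^sup>2"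
          using WL[of n] unfolding f_def ell2_nth_schr m_def by (simp add: algebra_simps)
        then show ?thesis unfolding m by simp
      qed
      then show ?thesis
        using vL(2)[of "\<lambda>n. ell2_nth \<psi> (- int n)" "Suc L"] \<psi> \<psi>0 by (simp add: h_def del: sum.lessThan_Suc)
    qed
    also have "\<dots> \<le> C * (\<Sum>n<Suc L. f (- int n - 1))"
      using C by (intro mult_right_mono sum_nonneg) (auto simp: f_def)
    finally have L: "(\<Sum>n<Suc L. h (- int n)) \<le> C * (\<Sum>n<Suc L. f (- int n - 1))" .
    have images: "(\<Sum>n<Suc L. F (int n + a) :: real) = (\<Sum>n\<in>{a..int L + a}. F n)"
      "(\<Sum>n<Suc L. F (- int n - a)) = (\<Sum>n\<in>{- int L - a..- a}. F n)" for F and a :: int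
      by (rule sum.reindex_bij_witness[of _ "\<lambda>n. nat (n - a)" "\<lambda>n. int n + a"]; auto)
        (rule sum.reindex_bij_witness[of _ "\<lambda>n. nat (- n - a)" "\<lambda>n. - int n - a"]; auto)
    \<comment> \<open>Site 0 may be counted twice in an upper bound. On the residual side the two
      ranges must be disjoint, and they are.\<close>
    have "(norm \<psi>)\<^sup>2 = (\<Sum>n\<in>{- int L..0} \<union> {0..int L}. h n)"
      unfolding h_def by (rule norm_ell2_finite_support) (use \<psi>(2) in \<open>auto simp: not_le\<close>)
    also have "\<dots> \<le> (\<Sum>n\<in>{- int L..0}. h n) + (\<Sum>n\<in>{0..int L}. h n)"
      by (subst sum_Un) (auto intro!: sum_nonneg simp: h_def)
    also have "\<dots> = (\<Sum>n<Suc L. h (- int n)) + (\<Sum>n<Suc L. h (int n))"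
      using images(1)[of h 0] images(2)[of h 0] by simp
    also have "\<dots> \<le> C * ((\<Sum>n<Suc L. f (- int n - 1)) + (\<Sum>n<Suc L. f (int n + 1)))"
      using R L by (simp add: distrib_left del: sum.lessThan_Suc)
    also have "\<dots> = C * (\<Sum>n\<in>{- int L - 1..- 1} \<union> {1..int L + 1}. f n)"
      unfolding images by (subst sum.union_disjoint) auto
    also have "\<dots> \<le> C * (norm (schr (V + W) E \<psi>))\<^sup>2"
      using C(1) unfolding f_def by (intro mult_left_mono sum_le_norm_ell2) auto
    also have "\<dots> < C * (1 / sqrt C * norm \<psi>)\<^sup>2"
      using \<psi>(3) C(1) by (intro mult_strict_left_mono power_strict_mono) auto
    also have "\<dots> = (norm \<psi>)\<^sup>2"
      using C(1) by (simp add: power_mult_distrib power_divide)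
    finally show False by simp
  qed
  with W(2) show thesis by (intro that[of "V + W"]) simp_all
qed

section \<open>Completeness of the space of potentials and the Baire argument\<close>

lemma complete_UNIV_bcontfun: "complete (UNIV :: ('a::topological_space \<Rightarrow>\<^sub>C 'b::complete_space) set)"
proof (rule completeI)
  fix f :: "nat \<Rightarrow> 'a \<Rightarrow>\<^sub>C 'b"
  assume "Cauchy f"
  then have "uniformly_Cauchy_on UNIV (\<lambda>n. apply_bcontfun (f n))"
    unfolding uniformly_Cauchy_on_def Cauchy_def by (meson dist_fun_lt_imp_dist_val_lt)
  then obtain g where "uniform_limit UNIV (\<lambda>n. apply_bcontfun (f n)) g sequentially"
    using Cauchy_uniformly_convergent unfolding uniformly_convergent_on_def by blast
  then show "\<exists>l\<in>UNIV. f \<longlonglongrightarrow> l"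
    by (rule uniform_limit_bcontfunE) auto
qed

lemma generic_countable_Inter:
  fixes \<G> :: "'a::metric_space set set"
  assumes "complete (UNIV :: 'a set)" "countable \<G>"
    and op: "\<And>U. U \<in> \<G> \<Longrightarrow> open U" and dense: "\<And>U. U \<in> \<G> \<Longrightarrow> closure U = UNIV"
    and P: "\<And>x. x \<in> \<Inter>\<G> \<Longrightarrow> P x"
  shows "generic P"
proof -
  have closure: "closure (\<Inter>\<G>) = UNIV"
    using Met_TC.metric_Baire_category[of \<G>] assms by simp
  have "gdelta (\<Inter>\<G>)"
  proof -
    \<comment> \<open>Inserting \<open>UNIV\<close> makes the enumerated family nonempty and leaves
      its intersection unchanged.\<close>
    let ?F = "from_nat_into (insert UNIV \<G>)"
    have "range ?F = insert UNIV \<G>" using assms(2) by (intro range_from_nat_into) auto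
    moreover have "open (?F n)" for n using from_nat_into[of "insert UNIV \<G>" n] op by auto
    then have "gdelta (\<Inter>(range ?F))" by (rule gdelta.intros)
    ultimately show ?thesis by simp
  qed
  with closure P show ?thesis unfolding generic_def by blast
qed

theorem theorem1p5:
  shows "generic (\<lambda>V :: potential.
    \<exists>K. cantor_set K \<and> essential_spectrum (schroedinger V) = complex_of_real ` K)"
proof -
  define meets where "meets a b = {V. \<exists>E\<in>weyl_spectrum V. a < E \<and> E < b}" for a b
  define avoid where "avoid E = {V. E \<notin> weyl_spectrum V}" for E
  \<comment> \<open>Both alternatives are open. A potential in the closure of
    \<open>meets a b\<close> is near one in \<open>meets a b\<close>, whose energy can then be
    split, so the condition is dense. A potential in \<open>meets a b\<close> is forced into the
    second alternative.\<close>
  define split where "split = (\<lambda>(a, b). - closure (meets a b) \<union> (\<Union>c\<in>{a<..<b}. meets a c \<inter> meets c b))"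
  \<comment> \<open>Rational energies and endpoints are dense enough for both properties and keep
    the family countable.\<close>
  define \<G> where "\<G> = avoid ` \<rat> \<union> split ` (\<rat> \<times> \<rat>)"
  have meets: "open (meets a b)" for a b unfolding meets_def by (rule open_weyl_spectrum_meets)
  have dense: "closure U = UNIV" if "\<And>V d. 0 < d \<Longrightarrow> \<exists>V'\<in>U. norm (V' - V) \<le> d" for U :: "potential set"
    unfolding set_eq_iff closure_approachable dist_norm
    using that by (metis UNIV_I half_gt_zero_iff field_sum_of_halves le_less_trans less_add_same_cancel1)
  show ?thesis
  proof (rule generic_countable_Inter[OF complete_UNIV_bcontfun])
    show "countable \<G>" unfolding \<G>_def by (intro countable_Un countable_image countable_SIGMA countable_rat)
    have "open (avoid E)" for E
      unfolding open_dist avoid_def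
    proof safe
      fix V assume "E \<notin> weyl_spectrum V"
      from not_in_weyl_spectrum_perturb[OF this] show "\<exists>e>0. \<forall>V'. dist V' V < e \<longrightarrow> V' \<in> {V. E \<notin> weyl_spectrum V}"
        by (auto simp: dist_norm)
    qed
    moreover have "open (split p)" for p
      unfolding split_def using meets by (cases p) (auto intro!: open_Un open_UN open_Int)
    ultimately show "open U" if "U \<in> \<G>" for U using that by (auto simp: \<G>_def)
    have "closure (avoid E) = UNIV" for E
      using exists_perturbation_outside_weyl_spectrum by (intro dense) (metis avoid_def mem_Collect_eq)
    moreover have "closure (split p) = UNIV" for p
    proof (rule dense)
      obtain a b where p: "p = (a, b)" by fastforce
      fix V :: potential and d :: real
      assume d: "0 < d"
      show "\<exists>V'\<in>split p. norm (V' - V) \<le> d"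
      proof (cases "V \<in> closure (meets a b)")
        case False
        then show ?thesis using d by (intro bexI[of _ V]) (auto simp: p split_def)
      next
        case True
        then obtain V1 where V1: "V1 \<in> meets a b" "norm (V1 - V) < d / 2"
          unfolding closure_approachable dist_norm using d by (meson half_gt_zero)
        then obtain E where E: "E \<in> weyl_spectrum V1" "a < E" "E < b" by (auto simp: meets_def)
        \<comment> \<open>Half of \<open>d\<close> went into reaching \<open>V1\<close>, the other
          half bounds the split. The second energy \<open>E + t\<close> stays below
          \<open>b\<close>, and \<open>E + t / 2\<close> separates the two.\<close>
        define t where "t = min (d / 2) ((b - E) / 2)"
        have t: "0 < t" "t \<le> d / 2" "E + t < b" using d E by (auto simp: t_def min_def field_simps)
        obtain V2 where V2: "norm (V2 - V1) \<le> max \<bar>0\<bar> \<bar>t\<bar>" "E + 0 \<in> weyl_spectrum V2" "E + t \<in> weyl_spectrum V2"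
          using weyl_spectrum_split[OF E(1)] by metis
        have "V2 \<in> meets a (E + t / 2) \<inter> meets (E + t / 2) b"
          using V2(2,3) E t by (force simp: meets_def)
        then have "V2 \<in> split p" using E t by (auto simp: p split_def intro!: bexI[of _ "E + t / 2"])
        moreover have "norm (V2 - V) \<le> d"
          using norm_triangle_ineq[of "V2 - V1" "V1 - V"] V1(2) V2(1) t by simp
        ultimately show ?thesis by blast
      qed
    qed
    ultimately show "closure U = UNIV" if "U \<in> \<G>" for U using that by (auto simp: \<G>_def)
    fix V assume "V \<in> \<Inter>\<G>"
    then have avoid: "\<And>E. E \<in> \<rat> \<Longrightarrow> E \<notin> weyl_spectrum V"
      and split: "\<And>a b. a \<in> \<rat> \<Longrightarrow> b \<in> \<rat> \<Longrightarrow> V \<in> split (a, b)"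
      by (auto simp: \<G>_def avoid_def)
    have iso: "\<not> E isolated_in weyl_spectrum V" for E
    proof
      assume "E isolated_in weyl_spectrum V"
      then obtain e where E: "E \<in> weyl_spectrum V" and "0 < e" and e: "\<And>y. y \<in> weyl_spectrum V \<Longrightarrow> dist E y < e \<Longrightarrow> y = E"
        unfolding isolated_in_dist_Ex_iff by blast
      obtain a b where ab: "a \<in> \<rat>" "b \<in> \<rat>" "E - e < a" "a < E" "E < b" "b < E + e"
        using Rats_dense_in_real[of "E - e" E] Rats_dense_in_real[of E "E + e"] \<open>0 < e\<close> by auto
      have "V \<in> meets a b" using E ab by (auto simp: meets_def)
      then have "V \<in> closure (meets a b)" using closure_subset by blast
      with split[OF ab(1,2)] obtain c x y where xy: "x \<in> weyl_spectrum V" "a < x" "x < c" "y \<in> weyl_spectrum V" "c < y" "y < b"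
        unfolding split_def meets_def by auto
      have "x = E" "y = E"
        using xy ab by (auto intro!: e simp: dist_real_def abs_less_iff)
      with xy show False by simp
    qed
    have "interior (weyl_spectrum V) = {}"
    proof (rule ccontr)
      assume "interior (weyl_spectrum V) \<noteq> {}"
      then obtain E e where "0 < e" "ball E e \<subseteq> weyl_spectrum V" by (auto simp: mem_interior)
      moreover obtain q where "q \<in> \<rat>" "E < q" "q < E + e"
        using Rats_dense_in_real[of E "E + e"] \<open>0 < e\<close> by auto
      ultimately show False using avoid[of q] by (auto simp: subset_iff dist_real_def)
    qed
    with iso compact_weyl_spectrum have "cantor_set (weyl_spectrum V)" by (simp add: cantor_set_def)
    with essential_spectrum_eq_weyl_spectrum[OF iso]
    show "\<exists>K. cantor_set K \<and> essential_spectrum (schroedinger V) = complex_of_real ` K" by blast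
  qed
qed

end
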